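(* Let $p$ be a prime, let $G$ be a finite $p$-group, and let $n$ be a non-negative integer such that $|G'| > p^{n(n-1)/2}$. Then there do not exist $p$ proper subgroups $H_1, \dots, H_p$ of $G$, at least one of which has index at least $p^2$ in $G$, such that every element $x \in G$ with $b(x) \geq n$ lies in $H_1 \cup \dots \cup H_p$.
   Context: $G'$ denotes the derived subgroup of $G$. For $x$ in a finite $p$-group $G$, the breadth $b(x)$ is defined by $|G : C_G(x)| = p^{b(x)}$, where $C_G(x)$ is the centralizer of $x$ in $G$. *)

theory Defs
  imports "HOL-Algebra.Algebra"
begin

definition centralizer :: "('a, 'b) monoid_scheme \<Rightarrow> 'a \<Rightarrow> 'a set" where
  "centralizer G x = {g \<in> carrier G. g \<otimes>\<^bsub>G\<^esub> x = x \<otimes>\<^bsub>G\<^esub> g}"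

text \<open>Breadth: the exponent b with |G : C_G(x)| = p^b (well defined in a finite p-group).\<close>
definition breadth :: "('a, 'b) monoid_scheme \<Rightarrow> nat \<Rightarrow> 'a \<Rightarrow> nat" where
  "breadth G p x = (THE b. card (rcosets\<^bsub>G\<^esub> (centralizer G x)) = p ^ b)"

definition p_group :: "('a, 'b) monoid_scheme \<Rightarrow> nat \<Rightarrow> bool" where
  "p_group G p \<longleftrightarrow> group G \<and> finite (carrier G) \<and> (\<exists>k. card (carrier G) = p ^ k)"

end

theory Submission
  imports Defs
begin

text \<open>
  Let all elements of \<open>G\<close> outside proper subgroups \<open>H\<^sub>1, \<dots>, H\<^sub>p\<close>, one of them of index at least
  \<open>p\<^sup>2\<close>, have breadth at most \<open>m\<close>; we show \<open>|G'| \<le> p\<^bsup>m(m+1)/2\<^esup>\<close> by induction on \<open>|G|\<close>. For a subgroup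
  \<open>S\<close> of index \<open>p\<close> let \<open>T\<close> consist of the elements of \<open>S\<close> that are central in \<open>G\<close> modulo \<open>S'\<close>. Then
  \<open>|G' : S'| = |S : T|\<close>, which is at most \<open>p\<^sup>m\<close>, and an element of \<open>S\<close> commuting with an element outside \<open>S\<close>
  lies in \<open>T\<close>; so the breadth of every element of \<open>S \<setminus> T\<close> drops when passing from \<open>G\<close> to \<open>S\<close>. It
  therefore suffices to choose \<open>S\<close> such that the subgroups \<open>S \<inter> H\<^sub>i\<close> together with \<open>T\<close> again satisfy the
  hypothesis. For \<open>p > 2\<close>, any suitable \<open>S\<close> containing \<open>H\<^sub>i \<inter> H\<^sub>j\<close> for some maximal \<open>H\<^sub>i \<noteq> H\<^sub>j\<close> does this,
  since then \<open>S \<inter> H\<^sub>i = S \<inter> H\<^sub>j\<close>. For \<open>p = 2\<close> this can fail if \<open>|S : T| = 2\<close>; in a counterexample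
  every suitable \<open>S\<close> then has a central element outside \<open>T\<close>, and comparing these elements for
  different \<open>S\<close> gives a contradiction.

  That \<open>x\<close> has breadth at most \<open>m\<close> in a subgroup \<open>A\<close> is expressed by
  \<open>card A \<le> p ^ m * card (centralizer_in A x)\<close>.
\<close>

section \<open>Counting: orders of subgroups, double cosets and products\<close>

lemma card_eq_fibers:
  assumes "finite M" and "\<And>y. y \<in> f ` M \<Longrightarrow> card {x \<in> M. f x = y} = n"
  shows "card M = n * card (f ` M)"
proof -
  have "card M = (\<Sum>x\<in>M. 1)" by simp
  also have "\<dots> = (\<Sum>y\<in>f ` M. \<Sum>x\<in>{x \<in> M. f x = y}. 1)"
    using assms(1) by (rule sum.image_gen)
  also have "\<dots> = (\<Sum>y\<in>f ` M. n)" using assms(2) by simp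
  finally show ?thesis by (simp add: mult.commute)
qed

locale finite_p_group = group G for G (structure) +
  fixes p :: nat
  assumes prime_p: "Factorial_Ring.prime p"
    and finite_G: "finite (carrier G)"
    and card_G: "\<exists>k. card (carrier G) = p ^ k"
begin

definition comm :: "'a \<Rightarrow> 'a \<Rightarrow> 'a" where
  "comm x y = x \<otimes> y \<otimes> inv x \<otimes> inv y"

text \<open>\<open>x\<close> need not lie in \<open>A\<close>: centralizers in \<open>S\<close> of
  elements outside \<open>S\<close> are what bounds |S : T|.\<close>

definition centralizer_in :: "'a set \<Rightarrow> 'a \<Rightarrow> 'a set" where
  "centralizer_in A x = {g \<in> A. g \<otimes> x = x \<otimes> g}"

definition centre_mod :: "'a set \<Rightarrow> 'a set \<Rightarrow> 'a set" where
  "centre_mod A S = {s \<in> S. \<forall>a\<in>A. comm a s \<in> derived G S}"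

definition index_p :: "'a set \<Rightarrow> 'a set \<Rightarrow> bool" where
  "index_p A S \<longleftrightarrow> subgroup S G \<and> S \<subseteq> A \<and> card A = p * card S"

lemma p_ge2: "p \<ge> 2" using prime_p by (rule prime_ge_2_nat)

lemma mult_inv_cancel [simp]:
  "x \<in> carrier G \<Longrightarrow> y \<in> carrier G \<Longrightarrow> inv x \<otimes> (x \<otimes> y) = y"
  "x \<in> carrier G \<Longrightarrow> y \<in> carrier G \<Longrightarrow> x \<otimes> (inv x \<otimes> y) = y"
  by (simp_all add: m_assoc[symmetric])

lemmas word = m_assoc inv_mult_group

lemma subgroup_carrier: "subgroup A G \<Longrightarrow> x \<in> A \<Longrightarrow> x \<in> carrier G"
  by (rule subgroup.mem_carrier)

lemma subgroup_finite: "subgroup A G \<Longrightarrow> finite A"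
  using finite_G finite_subset subgroup.subset by blast

lemma subgroup_card_pos: "subgroup A G \<Longrightarrow> card A > 0"
  using subgroup.finite_imp_card_positive finite_G by blast

lemma subgroup_card:
  assumes "subgroup A G" shows "\<exists>i. card A = p ^ i"
proof -
  obtain k where k: "card (carrier G) = p ^ k" using card_G by blast
  have "card (rcosets A) * card A = p ^ k"
    using lagrange[OF assms] k by (simp add: order_def)
  then have "card A dvd p ^ k" by (metis dvd_triv_right)
  then show ?thesis using divides_primepow_nat[OF prime_p] by blast
qed

text \<open>All orders are powers of \<open>p\<close>, so a strict inequality leaves room for a
  whole factor \<open>p\<close>.\<close>

lemma subgroup_card_less:
  assumes "subgroup A G" "subgroup B G" "card A < n * card B"  "n = p ^ l"
  shows "p * card A \<le> n * card B"
proof -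
  obtain i j where "card A = p ^ i" "card B = p ^ j" using subgroup_card assms by metis
  then have "p ^ i < p ^ (l + j)" using assms by (simp add: power_add)
  then have "Suc i \<le> l + j" using p_ge2 by simp
  then have "p ^ Suc i \<le> p ^ (l + j)" using p_ge2 by (intro power_increasing) auto
  then show ?thesis using \<open>card A = p ^ i\<close> \<open>card B = p ^ j\<close> assms by (simp add: power_add)
qed

lemma proper_card:
  assumes "subgroup A G" "subgroup B G" "A \<subset> B" shows "p * card A \<le> card B"
  using subgroup_card_less[of A B 1 0] assms psubset_card_mono[OF subgroup_finite] by simp

text \<open>The size formula for a double coset HaK: the pairs with product h a k are (h i, a^-1
  i^-1 a k), where i runs over the elements of \<open>H\<close> whose conjugate by \<open>a\<close>
  lies in \<open>K\<close>. Used with \<open>a = \<one>\<close> for products of subgroups and with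
  \<open>K = H\<close> for the growth of normalizers.\<close>

lemma fibers_mult:
  assumes H: "subgroup H G" and K: "subgroup K G" and a: "a \<in> carrier G"
  defines "f \<equiv> (\<lambda>(h, k). h \<otimes> a \<otimes> k)"
  shows "card H * card K = card {h \<in> H. inv a \<otimes> h \<otimes> a \<in> K} * card (f ` (H \<times> K))"
proof -
  let ?I = "{h \<in> H. inv a \<otimes> h \<otimes> a \<in> K}"
  have "card {x \<in> H \<times> K. f x = y} = card ?I" if y: "y \<in> f ` (H \<times> K)" for y
  proof -
    obtain h k where hk: "h \<in> H" "k \<in> K" "y = h \<otimes> a \<otimes> k" using y by (auto simp: f_def)
    note c = subgroup_carrier[OF H] subgroup_carrier[OF K] a
    have *: "{x \<in> H \<times> K. f x = y} = (\<lambda>i. (h \<otimes> i, inv a \<otimes> inv i \<otimes> a \<otimes> k)) ` ?I"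
    proof (intro equalityI subsetI)
      fix x assume "x \<in> {x \<in> H \<times> K. f x = y}"
      then obtain h' k' where x: "x = (h', k')" "h' \<in> H" "k' \<in> K" "h' \<otimes> a \<otimes> k' = h \<otimes> a \<otimes> k"
        using hk by (auto simp: f_def)
      have e: "a \<otimes> k' = inv h' \<otimes> (h \<otimes> (a \<otimes> k))"
        using x hk c by (simp add: inv_solve_left m_assoc)
      have "inv a \<otimes> (inv h \<otimes> h') \<otimes> a = k \<otimes> inv k'"
      proof -
        have "h' \<otimes> a = h \<otimes> a \<otimes> k \<otimes> inv k'" using x(4) x(2,3) hk c by (metis inv_solve_right m_closed)
        then show ?thesis using x hk c by (simp add: word)
      qed
      then have i: "inv h \<otimes> h' \<in> ?I"
        using x hk H K by (simp add: subgroup.m_closed subgroup.m_inv_closed)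
      moreover have "x = (\<lambda>i. (h \<otimes> i, inv a \<otimes> inv i \<otimes> a \<otimes> k)) (inv h \<otimes> h')"
      proof -
        have "k' = inv a \<otimes> (inv h' \<otimes> (h \<otimes> (a \<otimes> k)))"
          using e x hk c by (metis mult_inv_cancel(1))
        then show ?thesis using x(1-3) hk c by (simp add: word)
      qed
      ultimately show "x \<in> (\<lambda>i. (h \<otimes> i, inv a \<otimes> inv i \<otimes> a \<otimes> k)) ` ?I" by blast
    next
      fix x assume "x \<in> (\<lambda>i. (h \<otimes> i, inv a \<otimes> inv i \<otimes> a \<otimes> k)) ` ?I"
      then obtain i where i: "x = (h \<otimes> i, inv a \<otimes> inv i \<otimes> a \<otimes> k)" "i \<in> H" "inv a \<otimes> i \<otimes> a \<in> K" by blast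
      have "inv (inv a \<otimes> i \<otimes> a) \<otimes> k \<in> K" using i hk K by (simp add: subgroup.m_inv_closed subgroup.m_closed)
      then have "inv a \<otimes> inv i \<otimes> a \<otimes> k \<in> K" using i hk c by (simp add: word)
      then show "x \<in> {x \<in> H \<times> K. f x = y}"
        using i hk H K c by (auto simp: f_def word subgroup.m_closed)
    qed
    have "inj_on (\<lambda>i. (h \<otimes> i, inv a \<otimes> inv i \<otimes> a \<otimes> k)) ?I"
      using hk c by (auto simp: inj_on_def)
    then show ?thesis using * by (simp add: card_image)
  qed
  then have "card (H \<times> K) = card ?I * card (f ` (H \<times> K))"
    by (intro card_eq_fibers) (use H K subgroup_finite in auto)
  then show ?thesis by (simp add: card_cartesian_product)
qed

lemma card_set_mult:
  assumes H: "subgroup H G" and K: "subgroup K G"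
  shows "card H * card K = card (H \<inter> K) * card (H <#> K)"
proof -
  have "{h \<in> H. inv \<one> \<otimes> h \<otimes> \<one> \<in> K} = H \<inter> K"
    using subgroup_carrier[OF H] by auto
  moreover have "(\<lambda>(h, k). h \<otimes> \<one> \<otimes> k) ` (H \<times> K) = H <#> K"
    using subgroup_carrier[OF H] by (force simp: set_mult_def)
  ultimately show ?thesis using fibers_mult[OF H K one_closed] by simp
qed

lemma subgroup_inter: "subgroup A G \<Longrightarrow> subgroup B G \<Longrightarrow> subgroup (A \<inter> B) G"
  by (rule subgroups_Inter_pair)

lemma card_inter:
  assumes "subgroup H G" "subgroup K G" "subgroup A G" "H \<subseteq> A" "K \<subseteq> A"
  shows "card H * card K \<le> card A * card (H \<inter> K)"
proof -
  have "H <#> K \<subseteq> A" using assms by (auto simp: set_mult_def subgroup.m_closed subset_iff)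
  then have "card (H <#> K) \<le> card A" using assms by (simp add: card_mono subgroup_finite)
  then show ?thesis using card_set_mult[OF assms(1,2)] by (simp add: mult.commute)
qed

lemma set_multI: "n \<in> N \<Longrightarrow> h \<in> H \<Longrightarrow> n \<otimes> h \<in> N <#> H"
  by (auto simp: set_mult_def)

lemma subgroup_set_mult:
  assumes N: "subgroup N G" and H: "subgroup H G"
    and conj: "\<And>h n. h \<in> H \<Longrightarrow> n \<in> N \<Longrightarrow> h \<otimes> n \<otimes> inv h \<in> N"
  shows "subgroup (N <#> H) G"
proof (rule subgroupI)
  note c = subgroup_carrier[OF H] subgroup_carrier[OF N]
  note cl = subgroup.m_closed[OF H] subgroup.m_closed[OF N] subgroup.m_inv_closed[OF H] subgroup.m_inv_closed[OF N]
  show "N <#> H \<subseteq> carrier G" using c by (auto simp: set_mult_def)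
  show "N <#> H \<noteq> {}" using H N by (force simp: set_mult_def dest: subgroup.one_closed)
  fix x assume "x \<in> N <#> H"
  then obtain n h where x: "n \<in> N" "h \<in> H" "x = n \<otimes> h" by (auto simp: set_mult_def)
  have "inv x = (inv h \<otimes> inv n \<otimes> inv (inv h)) \<otimes> inv h" using x c by (simp add: word)
  moreover have "inv h \<otimes> inv n \<otimes> inv (inv h) \<in> N" by (intro conj cl(3,4) x(1,2))
  ultimately show "inv x \<in> N <#> H" using set_multI cl(3)[OF x(2)] by metis
  fix y assume "y \<in> N <#> H"
  then obtain n' h' where y: "n' \<in> N" "h' \<in> H" "y = n' \<otimes> h'" by (auto simp: set_mult_def)
  have "x \<otimes> y = (n \<otimes> (h \<otimes> n' \<otimes> inv h)) \<otimes> (h \<otimes> h')" using x y c by (simp add: word)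
  then show "x \<otimes> y \<in> N <#> H" 
    using set_multI[OF cl(2)[OF x(1) conj[OF x(2) y(1)]] cl(1)[OF x(2) y(2)]] by simp
qed

lemma set_mult_incl:
  assumes "subgroup N G" "subgroup H G"
  shows "N \<subseteq> N <#> H" "H \<subseteq> N <#> H"
proof -
  show "N \<subseteq> N <#> H"
  proof
    fix x assume "x \<in> N"
    then have "x \<otimes> \<one> \<in> N <#> H" by (rule set_multI[OF _ subgroup.one_closed[OF assms(2)]])
    then show "x \<in> N <#> H" using \<open>x \<in> N\<close> assms subgroup_carrier by simp
  qed
  show "H \<subseteq> N <#> H"
  proof
    fix x assume "x \<in> H"
    then have "\<one> \<otimes> x \<in> N <#> H" by (rule set_multI[OF subgroup.one_closed[OF assms(1)]])
    then show "x \<in> N <#> H" using \<open>x \<in> H\<close> assms subgroup_carrier by simp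
  qed
qed

subsection \<open>Subgroups of index \<open>p\<close>\<close>

text \<open>Otherwise all double cosets of \<open>H\<close> in \<open>A\<close> except \<open>H\<close> itself have size divisible by \<open>p |H|\<close>.\<close>

lemma normalizer_grows:
  assumes H: "subgroup H G" and A: "subgroup A G" and HA: "H \<subset> A"
  shows "\<exists>a\<in>A - H. \<forall>h\<in>H. inv a \<otimes> h \<otimes> a \<in> H"
proof (rule ccontr)
  assume no: "\<not> ?thesis"
  define D where "D a = (\<lambda>(h, k). h \<otimes> a \<otimes> k) ` (H \<times> H)" for a
  note cH = subgroup_carrier[OF H] and cA = subgroup_carrier[OF A]
  have sub: "H \<subseteq> A" using HA by blast
  have DI: "h \<otimes> a \<otimes> k \<in> D a" if "h \<in> H" "k \<in> H" for h k a
    using that unfolding D_def by (intro image_eqI[of _ _ "(h, k)"]) auto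
  have dvd: "p * card H dvd card (D a)" if a: "a \<in> A - H" for a
  proof -
    let ?I = "{h \<in> H. inv a \<otimes> h \<otimes> a \<in> H}"
    have ac: "a \<in> carrier G" using a cA by blast
    have I: "subgroup ?I G"
    proof (rule subgroupI)
      show "?I \<subseteq> carrier G" using cH by blast
      show "?I \<noteq> {}" using H ac subgroup.one_closed by fastforce
      fix x assume x: "x \<in> ?I"
      have "inv (inv a \<otimes> x \<otimes> a) \<in> H" using x H by (simp add: subgroup.m_inv_closed)
      then show "inv x \<in> ?I" using x H ac cH by (simp add: word subgroup.m_inv_closed)
      fix y assume y: "y \<in> ?I"
      have "(inv a \<otimes> x \<otimes> a) \<otimes> (inv a \<otimes> y \<otimes> a) \<in> H" using x y H by (simp add: subgroup.m_closed)
      then show "x \<otimes> y \<in> ?I" using x y H ac cH by (simp add: word subgroup.m_closed)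
    qed
    \<comment> \<open>The double coset consists of |H : ?I| left cosets of \<open>H\<close>; by
      \<open>no\<close> this index is not 1, hence divisible by \<open>p\<close>.\<close>
    have "?I \<subset> H" using no a by blast
    then have "p * card ?I \<le> card H" using proper_card[OF I H] by blast
    moreover obtain i j where ij: "card ?I = p ^ i" "card H = p ^ j"
      using subgroup_card[OF I] subgroup_card[OF H] by blast
    ultimately have "p ^ Suc i \<le> p ^ j" by simp
    then have le: "Suc i \<le> j" using p_ge2 by (simp add: power_increasing_iff del: power_Suc)
    have "p ^ j * p ^ j = p ^ i * card (D a)"
      using fibers_mult[OF H H ac] ij unfolding D_def by simp
    moreover have "p ^ j * p ^ j = p ^ i * (p ^ (j - i) * p ^ j)" using le
      by (simp flip: power_add mult.assoc)
    ultimately have "card (D a) = p ^ (j - i) * p ^ j" using p_ge2 by simp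
    moreover have "p dvd p ^ (j - i)" using le by (simp add: dvd_power)
    ultimately show ?thesis using ij by (simp add: mult_dvd_mono)
  qed
  have self: "a \<in> D a" if "a \<in> A" for a
  proof -
    have "\<one> \<otimes> a \<otimes> \<one> \<in> D a" using H by (intro DI) (simp_all add: subgroup.one_closed)
    then show ?thesis using that cA by simp
  qed
  have D_eq: "D b = D a" if a: "a \<in> A" and b: "b \<in> D a" for a b
  proof -
    obtain h k where hk: "h \<in> H" "k \<in> H" "b = h \<otimes> a \<otimes> k" using b by (auto simp: D_def)
    have ac: "a \<in> carrier G" using a cA by blast
    show ?thesis
    proof (intro equalityI subsetI)
      fix x assume "x \<in> D b"
      then obtain h' k' where x: "h' \<in> H" "k' \<in> H" "x = h' \<otimes> b \<otimes> k'" by (auto simp: D_def)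
      have "x = (h' \<otimes> h) \<otimes> a \<otimes> (k \<otimes> k')" using x hk ac cH by (simp add: word)
      then show "x \<in> D a" using DI[of "h' \<otimes> h" "k \<otimes> k'" a] x hk H by (simp add: subgroup.m_closed)
    next
      fix x assume "x \<in> D a"
      then obtain h' k' where x: "h' \<in> H" "k' \<in> H" "x = h' \<otimes> a \<otimes> k'" by (auto simp: D_def)
      have "x = (h' \<otimes> inv h) \<otimes> b \<otimes> (inv k \<otimes> k')" using x hk ac cH by (simp add: word)
      then show "x \<in> D b" using DI[of "h' \<otimes> inv h" "inv k \<otimes> k'" b] x hk H
        by (simp add: subgroup.m_closed subgroup.m_inv_closed)
    qed
  qed
  have U: "\<Union> (D ` (A - H)) = A - H"
  proof (intro equalityI subsetI)
    fix x assume "x \<in> \<Union> (D ` (A - H))"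
    then obtain a h k where x: "a \<in> A - H" "h \<in> H" "k \<in> H" "x = h \<otimes> a \<otimes> k" by (auto simp: D_def)
    have ac: "a \<in> carrier G" using x cA by blast
    have "x \<in> A" using x sub subgroup.m_closed[OF A] by blast
    moreover have "x \<notin> H"
    proof
      assume "x \<in> H"
      then have "inv h \<otimes> x \<otimes> inv k \<in> H"
        by (meson x(2,3) subgroup.m_closed[OF H] subgroup.m_inv_closed[OF H])
      moreover have "inv h \<otimes> x \<otimes> inv k = a"
        unfolding x(4) using ac cH[OF x(2)] cH[OF x(3)] by (simp add: word)
      ultimately have "a \<in> H" by metis
      then show False using x(1) by blast
    qed
    ultimately show "x \<in> A - H" by blast
  qed (use self in blast)
  have "p * card H dvd card (\<Union> (D ` (A - H)))"
  proof (rule dvd_partition)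
    show "finite (\<Union> (D ` (A - H)))" unfolding U using A by (simp add: subgroup_finite)
    show "\<forall>c\<in>D ` (A - H). p * card H dvd card c" using dvd by blast
    show "\<forall>c1\<in>D ` (A - H). \<forall>c2\<in>D ` (A - H). c1 \<noteq> c2 \<longrightarrow> c1 \<inter> c2 = {}"
      using D_eq by blast
  qed
  then have "p * card H dvd card (A - H)" by (simp only: U)
  moreover have "card A = card (A - H) + card H"
    using sub A H by (metis card_Diff_subset card_mono le_add_diff_inverse2 subgroup_finite)
  moreover have "p * card H dvd card A"
  proof -
    obtain i j where ij: "card H = p ^ i" "card A = p ^ j" using subgroup_card[OF H] subgroup_card[OF A] by blast
    have "p ^ Suc i \<le> p ^ j" using proper_card[OF H A HA] ij by simp
    then have "Suc i \<le> j" using p_ge2 by (simp add: power_increasing_iff del: power_Suc)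
    then show ?thesis using ij by (metis le_imp_power_dvd power_Suc)
  qed
  ultimately have "p * card H dvd card H" by (metis dvd_add_right_iff)
  then show False using subgroup_card_pos[OF H] p_ge2 by (simp add: nat_dvd_not_less)
qed


text \<open>Only inclusion of the conjugates in \<open>H\<close> is demanded. As \<open>H\<close> is
  finite, the injective conjugation map is onto, which yields closure under inverses.\<close>

lemma normalizer_subgroup:
  assumes H: "subgroup H G" and A: "subgroup A G"
  shows "subgroup {a \<in> A. \<forall>h\<in>H. a \<otimes> h \<otimes> inv a \<in> H} G" (is "subgroup ?N G")
proof (rule subgroupI)
  note cH = subgroup_carrier[OF H] and cA = subgroup_carrier[OF A]
  show "?N \<subseteq> carrier G" using cA by blast
  have "\<one> \<in> ?N" using A cH by (simp add: subgroup.one_closed)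
  then show "?N \<noteq> {}" by blast
  fix a assume a: "a \<in> ?N"
  let ?f = "\<lambda>h. a \<otimes> h \<otimes> inv a"
  have "inj_on ?f H" using a cA cH by (auto simp: inj_on_def)
  moreover have "?f ` H \<subseteq> H" using a by blast
  ultimately have surj: "?f ` H = H" using subgroup_finite[OF H] by (simp add: endo_inj_surj)
  have "inv a \<otimes> h \<otimes> inv (inv a) \<in> H" if h: "h \<in> H" for h
  proof -
    obtain h' where h': "h' \<in> H" "h = ?f h'" using surj h by blast
    have "inv a \<otimes> ?f h' \<otimes> inv (inv a) = h'" using h'(1) a cA cH by (simp add: word)
    then show ?thesis using h' by simp
  qed
  then show "inv a \<in> ?N" using a A by (simp add: subgroup.m_inv_closed)
  fix b assume b: "b \<in> ?N"
  have "a \<otimes> b \<otimes> h \<otimes> inv (a \<otimes> b) \<in> H" if h: "h \<in> H" for h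
  proof -
    have "?f (b \<otimes> h \<otimes> inv b) \<in> H" using a b h by blast
    moreover have "?f (b \<otimes> h \<otimes> inv b) = a \<otimes> b \<otimes> h \<otimes> inv (a \<otimes> b)" using a b h cA cH by (simp add: word)
    ultimately show ?thesis by simp
  qed
  then show "a \<otimes> b \<in> ?N" using a b A by (simp add: subgroup.m_closed)
qed

lemma normalizer_proper:
  assumes H: "subgroup H G" and A: "subgroup A G" and HA: "H \<subset> A"
  shows "H \<subset> {a \<in> A. \<forall>h\<in>H. a \<otimes> h \<otimes> inv a \<in> H}"
proof -
  note cH = subgroup_carrier[OF H] and cA = subgroup_carrier[OF A]
  obtain a where a: "a \<in> A - H" "\<forall>h\<in>H. inv a \<otimes> h \<otimes> a \<in> H"
    using normalizer_grows[OF assms] by blast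
  have "inv a \<in> {a \<in> A. \<forall>h\<in>H. a \<otimes> h \<otimes> inv a \<in> H}"
    using a cA A by (simp add: subgroup.m_inv_closed)
  moreover have "inv a \<notin> H" using a cA subgroup.m_inv_closed[OF H, of "inv a"] by auto
  moreover have "H \<subseteq> {a \<in> A. \<forall>h\<in>H. a \<otimes> h \<otimes> inv a \<in> H}"
    using HA subgroup.m_closed[OF H] subgroup.m_inv_closed[OF H] by auto
  ultimately show ?thesis by blast
qed

lemma index_pD:
  assumes "index_p A S"
  shows "subgroup S G" "S \<subseteq> A" "card A = p * card S"
  using assms by (auto simp: index_p_def)

lemma index_p_proper: "index_p A S \<Longrightarrow> S \<subset> A"
  using p_ge2 subgroup_card_pos[of S] by (auto simp: index_p_def)

text \<open>\<open>U \<inter> A\<close> properly contains \<open>S\<close>, so its order is at least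
  \<open>p * card S\<close>. Mostly used as an induction rule: a property that defines a subgroup
  extends from \<open>S\<close> and one element outside \<open>S\<close> to all of
  \<open>A\<close>.\<close>

lemma index_p_maximal:
  assumes A: "subgroup A G" and S: "index_p A S" and U: "subgroup U G" "S \<subseteq> U" and x: "x \<in> U" "x \<in> A" "x \<notin> S"
  shows "A \<subseteq> U"
proof -
  have "S \<subset> U \<inter> A" using U x index_pD[OF S] by blast
  then have "card A \<le> card (U \<inter> A)"
    using proper_card[of S "U \<inter> A"] index_pD[OF S] subgroup_inter U A by simp
  then have "U \<inter> A = A" using subgroup_finite[OF A] by (meson card_seteq inf_le2)
  then show ?thesis by blast
qed

text \<open>The normalizer of \<open>S\<close> in \<open>A\<close> is larger than \<open>S\<close>,
  hence all of \<open>A\<close> by maximality.\<close>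

lemma index_p_conj:
  assumes A: "subgroup A G" and S: "index_p A S" and a: "a \<in> A" "s \<in> S"
  shows "a \<otimes> s \<otimes> inv a \<in> S"
proof -
  let ?N = "{a \<in> A. \<forall>h\<in>S. a \<otimes> h \<otimes> inv a \<in> S}"
  note N = normalizer_proper[OF index_pD(1)[OF S] A index_p_proper[OF S]]
  then obtain x where "x \<in> ?N" "x \<notin> S" by blast
  then have "A \<subseteq> ?N"
    using index_p_maximal[OF A S normalizer_subgroup[OF index_pD(1)[OF S] A]] N by blast
  then show ?thesis using a by blast
qed

text \<open>Dividing the exponent by \<open>p\<close> writes y^k as y^(k mod p) times a power of
  y^p, so \<open>p\<close> translates of \<open>S \<inter> generate G {y}\<close> cover the cyclic
  group.\<close>

lemma card_generate_le:
  assumes S: "subgroup S G" and y: "y \<in> carrier G" "y [^] p \<in> S"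
  shows "card (generate G {y}) \<le> p * card (S \<inter> generate G {y})"
proof -
  let ?C = "generate G {y}"
  have C: "subgroup ?C G" using y by (simp add: generate_is_subgroup)
  let ?f = "\<lambda>(i::nat, c). y [^] i \<otimes> c"
  have "?C \<subseteq> ?f ` ({0..<p} \<times> (S \<inter> ?C))"
  proof
    fix c assume "c \<in> ?C"
    then obtain k :: int where k: "c = y [^] k" using generate_pow[OF y(1)] by blast
    let ?i = "nat (k mod int p)" and ?d = "(y [^] p) [^] (k div int p)"
    have "k = int p * (k div int p) + k mod int p" by simp
    then have "c = y [^] (k mod int p) \<otimes> y [^] (int p * (k div int p))"
      using k y by (metis add.commute int_pow_mult)
    also have "y [^] (int p * (k div int p)) = ?d" using y by (simp add: int_pow_int flip: int_pow_pow)
    also have "y [^] (k mod int p) = y [^] ?i" using p_ge2 by (simp flip: int_pow_int)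
    finally have "c = y [^] ?i \<otimes> ?d" .
    moreover have "y \<in> ?C" using generate.incl by fast
    then have "y [^] p \<in> ?C" using subgroup_int_pow_closed[OF C] by (metis int_pow_int)
    then have "?d \<in> S \<inter> ?C" using y S C subgroup_int_pow_closed by blast
    moreover have "?i \<in> {0..<p}" using p_ge2 by (simp add: nat_less_iff)
    ultimately show "c \<in> ?f ` ({0..<p} \<times> (S \<inter> ?C))" by (intro image_eqI[of _ _ "(?i, ?d)"]) simp_all
  qed
  then have "card ?C \<le> card (?f ` ({0..<p} \<times> (S \<inter> ?C)))"
    using S subgroup_finite by (intro card_mono) auto
  also have "\<dots> \<le> card ({0..<p} \<times> (S \<inter> ?C))" using S subgroup_finite by (intro card_image_le) auto
  finally show ?thesis by (simp add: card_cartesian_product)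
qed

text \<open>Among the iterated \<open>p\<close>-th powers of \<open>x\<close> the last one outside
  \<open>S\<close> works; the sequence reaches \<open>\<one>\<close> because the order of
  \<open>G\<close> is a power of \<open>p\<close>.\<close>

lemma pth_power_exists:
  assumes S: "subgroup S G" and A: "subgroup A G" and x: "x \<in> A - S"
  shows "\<exists>y\<in>A - S. y [^] p \<in> S"
proof -
  obtain k where k: "card (carrier G) = p ^ k" using card_G by blast
  have xc: "x \<in> carrier G" using x subgroup_carrier[OF A] by blast
  have "x [^] (p ^ k) = \<one>" using pow_order_eq_1[OF xc] k by (simp add: order_def)
  then have ex: "x [^] (p ^ k) \<in> S" using S by (simp add: subgroup.one_closed)
  define i where "i = (LEAST i. x [^] (p ^ i) \<in> S)"
  have i: "x [^] (p ^ i) \<in> S" unfolding i_def using ex by (rule LeastI)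
  have "i \<noteq> 0" using i x xc by (cases i) auto
  then obtain j where j: "i = Suc j" by (cases i) auto
  have "x [^] (p ^ j) \<notin> S" using not_less_Least[of j "\<lambda>i. x [^] (p ^ i) \<in> S"] j i_def by simp
  moreover have "x [^] (p ^ j) \<in> A" using x A subgroup_int_pow_closed[of A x "int (p ^ j)"] by (simp add: int_pow_int del: of_nat_power)
  moreover have "(x [^] (p ^ j)) [^] p = x [^] (p ^ i)" using xc j by (simp add: nat_pow_pow mult.commute)
  ultimately show ?thesis using i by (intro bexI[of _ "x [^] (p ^ j)"]) auto
qed

text \<open>A largest proper subgroup \<open>S\<close> containing \<open>H\<close> is normal in
  \<open>A\<close>, and adjoining one element whose \<open>p\<close>-th power lies in
  \<open>S\<close> already gives \<open>A\<close>; this bounds the index by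
  \<open>p\<close>.\<close>

lemma index_p_exists:
  assumes H: "subgroup H G" and A: "subgroup A G" and HA: "H \<subset> A"
  shows "\<exists>S. index_p A S \<and> H \<subseteq> S"
proof -
  let ?P = "\<lambda>S. subgroup S G \<and> H \<subseteq> S \<and> S \<subset> A"
  have "?P H" using H HA by simp
  moreover have "\<forall>U. ?P U \<longrightarrow> card U < Suc (card A)"
    using card_mono[OF subgroup_finite[OF A]] by (simp add: less_Suc_eq_le psubset_imp_subset)
  ultimately obtain S where S: "?P S" and max: "\<And>U. ?P U \<Longrightarrow> card U \<le> card S"
    using ex_has_greatest_nat[of ?P H card "Suc (card A)"] by blast
  have big: "U = A" if U: "subgroup U G" "S \<subset> U" "U \<subseteq> A" for U
  proof (rule ccontr)
    assume "U \<noteq> A"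
    then have "card U \<le> card S" using U S by (intro max) auto
    then show False using psubset_card_mono[OF subgroup_finite[OF U(1)] U(2)] by simp
  qed
  have norm: "{a \<in> A. \<forall>h\<in>S. a \<otimes> h \<otimes> inv a \<in> S} = A"
    using S by (intro big normalizer_subgroup normalizer_proper A) auto
  obtain x where "x \<in> A - S" using S by blast
  then obtain y where y: "y \<in> A - S" "y [^] p \<in> S" using pth_power_exists S A by blast
  let ?C = "generate G {y}"
  have yc: "y \<in> carrier G" using y subgroup_carrier[OF A] by blast
  then have C: "subgroup ?C G" by (simp add: generate_is_subgroup)
  have CA: "?C \<subseteq> A" using y A by (intro generate_subgroup_incl) auto
  have yC: "y \<in> ?C" by (rule generate.incl) simp
  have S': "subgroup S G" using S by blast
  have sub: "subgroup (S <#> ?C) G"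
  proof (rule subgroup_set_mult[OF S' C])
    fix h n assume "h \<in> ?C" "n \<in> S"
    then show "h \<otimes> n \<otimes> inv h \<in> S" using norm CA by blast
  qed
  have "S <#> ?C = A"
  proof (rule big[OF sub])
    show "S \<subset> S <#> ?C" using set_mult_incl[OF S' C] y yC by blast
    show "S <#> ?C \<subseteq> A" using S CA A by (auto simp: set_mult_def subset_iff subgroup.m_closed)
  qed
  then have "card (S \<inter> ?C) * card A = card S * card ?C" using card_set_mult[OF S' C] by simp
  also have "\<dots> \<le> card (S \<inter> ?C) * (p * card S)"
    using card_generate_le[OF S' yc y(2)] by (simp add: mult.commute mult.left_commute mult_le_mono)
  finally have "card A \<le> p * card S"
    using subgroup_card_pos[OF subgroup_inter[OF S' C]] by simp
  then have "card A = p * card S" using proper_card[of S A] S A by simp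
  then show ?thesis using S unfolding index_p_def by blast
qed

subsection \<open>Commutators and breadth\<close>

lemma comm_closed [simp]: "x \<in> carrier G \<Longrightarrow> y \<in> carrier G \<Longrightarrow> comm x y \<in> carrier G"
  by (simp add: comm_def)

lemma comm_eq_one:
  assumes "x \<in> carrier G" "y \<in> carrier G"
  shows "comm x y = \<one> \<longleftrightarrow> x \<otimes> y = y \<otimes> x"
proof -
  have "comm x y = (x \<otimes> y) \<otimes> inv (y \<otimes> x)" using assms by (simp add: comm_def word)
  then show ?thesis using assms by (simp add: inv_solve_right' del: inv_mult_group)
qed

lemma comm_derived: "x \<in> A \<Longrightarrow> y \<in> A \<Longrightarrow> comm x y \<in> derived G A"
  unfolding derived_def comm_def by (rule generate.incl) blast

lemma derived_least:
  assumes "subgroup L G" "\<And>x y. x \<in> A \<Longrightarrow> y \<in> A \<Longrightarrow> comm x y \<in> L"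
  shows "derived G A \<subseteq> L"
  unfolding derived_def by (rule generate_subgroup_incl[OF _ assms(1)]) (use assms(2) in \<open>auto simp: comm_def\<close>)

lemma derived_subgroup: "subgroup A G \<Longrightarrow> subgroup (derived G A) G"
  by (simp add: derived_is_subgroup subgroup.subset)

lemma derived_sub: "subgroup A G \<Longrightarrow> derived G A \<subseteq> A"
  by (rule derived_incl) auto

lemma derived_conj:
  assumes S: "subgroup S G" and a: "a \<in> carrier G" and conj: "\<And>s. s \<in> S \<Longrightarrow> a \<otimes> s \<otimes> inv a \<in> S"
    and l: "l \<in> derived G S"
  shows "a \<otimes> l \<otimes> inv a \<in> derived G S"
proof -
  let ?D = "derived G S"
  note cS = subgroup_carrier[OF S]
  have D: "subgroup ?D G" by (rule derived_subgroup[OF S])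
  note cD = subgroup_carrier[OF D]
  have "?D \<subseteq> {l \<in> carrier G. a \<otimes> l \<otimes> inv a \<in> ?D}"
  proof (rule derived_least)
    show "subgroup {l \<in> carrier G. a \<otimes> l \<otimes> inv a \<in> ?D} G" (is "subgroup ?L G")
    proof (rule subgroupI)
      show "?L \<subseteq> carrier G" by blast
      have "\<one> \<in> ?L" using a D by (simp add: subgroup.one_closed)
      then show "?L \<noteq> {}" by blast
      fix x assume x: "x \<in> ?L"
      then have "inv (a \<otimes> x \<otimes> inv a) \<in> ?D" using D by (simp add: subgroup.m_inv_closed)
      then show "inv x \<in> ?L" using x a by (simp add: word)
      fix y assume y: "y \<in> ?L"
      have "(a \<otimes> x \<otimes> inv a) \<otimes> (a \<otimes> y \<otimes> inv a) \<in> ?D" using x y D by (simp add: subgroup.m_closed)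
      then show "x \<otimes> y \<in> ?L" using x y a by (simp add: word)
    qed
    fix x y assume xy: "x \<in> S" "y \<in> S"
    have "comm (a \<otimes> x \<otimes> inv a) (a \<otimes> y \<otimes> inv a) \<in> ?D" using xy conj by (intro comm_derived)
    moreover have "comm (a \<otimes> x \<otimes> inv a) (a \<otimes> y \<otimes> inv a) = a \<otimes> comm x y \<otimes> inv a"
      using xy cS a by (simp add: comm_def word)
    ultimately show "comm x y \<in> ?L" using xy cS by simp
  qed
  then show ?thesis using l by blast
qed

lemma index_p_derived_conj:
  assumes "subgroup A G" "index_p A S" "a \<in> A" "l \<in> derived G S"
  shows "a \<otimes> l \<otimes> inv a \<in> derived G S"
  using assms by (intro derived_conj index_p_conj) (auto dest: index_pD subgroup_carrier)

text \<open>By the identity comm (a b) s = (a comm b s a^-1) comm a s, as \<open>L\<close> is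
  normalized by \<open>A\<close>.\<close>

lemma comm_mod_subgroup:
  assumes A: "subgroup A G" and L: "subgroup L G"
    and conj: "\<And>a l. a \<in> A \<Longrightarrow> l \<in> L \<Longrightarrow> a \<otimes> l \<otimes> inv a \<in> L" and s: "s \<in> carrier G"
  shows "subgroup {a \<in> A. comm a s \<in> L} G" (is "subgroup ?U G")
proof (rule subgroupI)
  note c = subgroup_carrier[OF A] subgroup_carrier[OF L]
  show "?U \<subseteq> carrier G" using c by blast
  have "\<one> \<in> ?U" using s A L by (simp add: subgroup.one_closed comm_def)
  then show "?U \<noteq> {}" by blast
  fix a assume a: "a \<in> ?U"
  have "inv a \<otimes> inv (comm a s) \<otimes> inv (inv a) \<in> L" using a A L by (intro conj) (auto simp: subgroup.m_inv_closed)
  moreover have "inv a \<otimes> inv (comm a s) \<otimes> inv (inv a) = comm (inv a) s" using a s c by (simp add: comm_def word)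
  ultimately show "inv a \<in> ?U" using a A by (simp add: subgroup.m_inv_closed)
  fix b assume b: "b \<in> ?U"
  have "(a \<otimes> comm b s \<otimes> inv a) \<otimes> comm a s \<in> L" using a b L conj by (simp add: subgroup.m_closed)
  moreover have "(a \<otimes> comm b s \<otimes> inv a) \<otimes> comm a s = comm (a \<otimes> b) s" using a b s c by (simp add: comm_def word)
  ultimately show "a \<otimes> b \<in> ?U" using a b A by (simp add: subgroup.m_closed)
qed

lemma inv_comm: "x \<in> carrier G \<Longrightarrow> y \<in> carrier G \<Longrightarrow> inv (comm x y) = comm y x"
  by (simp add: comm_def word)

lemma comm_swap_in:
  "subgroup L G \<Longrightarrow> x \<in> carrier G \<Longrightarrow> y \<in> carrier G \<Longrightarrow> comm x y \<in> L \<Longrightarrow> comm y x \<in> L"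
  using inv_comm[of x y] subgroup.m_inv_closed by metis

text \<open>One test element \<open>x\<close> suffices: the \<open>a\<close> with
  \<open>comm a s\<close> in S' form a subgroup containing \<open>S\<close>, which is maximal in
  \<open>A\<close>.\<close>

lemma centre_mod_iff:
  assumes A: "subgroup A G" and S: "index_p A S" and x: "x \<in> A" "x \<notin> S" and s: "s \<in> S"
  shows "s \<in> centre_mod A S \<longleftrightarrow> comm x s \<in> derived G S"
proof
  assume "comm x s \<in> derived G S"
  let ?U = "{a \<in> A. comm a s \<in> derived G S}"
  have "subgroup ?U G"
    using A S s by (intro comm_mod_subgroup index_p_derived_conj derived_subgroup) (auto dest: index_pD subgroup_carrier)
  moreover have "S \<subseteq> ?U" using s comm_derived index_pD(2)[OF S] by blast
  ultimately have "A \<subseteq> ?U" using index_p_maximal[OF A S] x \<open>comm x s \<in> _\<close> by blast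
  then show "s \<in> centre_mod A S" using s by (auto simp: centre_mod_def)
qed (use x in \<open>auto simp: centre_mod_def\<close>)

lemma centre_mod_sub: "centre_mod A S \<subseteq> S" by (auto simp: centre_mod_def)

lemma centre_mod_subgroup:
  assumes A: "subgroup A G" and S: "index_p A S"
  shows "subgroup (centre_mod A S) G"
proof -
  obtain x where x: "x \<in> A" "x \<notin> S" using index_p_proper[OF S] by blast
  have xc: "x \<in> carrier G" using x A subgroup_carrier by blast
  note cS = subgroup_carrier[OF index_pD(1)[OF S]]
  note D = derived_subgroup[OF index_pD(1)[OF S]]
  \<comment> \<open>The varying element becomes the first argument of \<open>comm\<close>, as
    \<open>comm_mod_subgroup\<close> requires.\<close>
  have "centre_mod A S = {s \<in> S. comm s x \<in> derived G S}"
    using centre_mod_iff[OF A S x] comm_swap_in[OF D] xc cS centre_mod_sub by blast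
  moreover have "subgroup {s \<in> S. comm s x \<in> derived G S} G"
    using A S index_pD[OF S] xc D by (intro comm_mod_subgroup index_p_derived_conj[OF A S]) auto
  ultimately show ?thesis by simp
qed

text \<open>Commuting with an element outside \<open>S\<close> gives a trivial commutator, and
  \<open>centre_mod_iff\<close> turns this into membership in T.\<close>

lemma centralizer_in_sub_if_not_centre_mod:
  assumes A: "subgroup A G" and S: "index_p A S" and y: "y \<in> S" "y \<notin> centre_mod A S"
  shows "centralizer_in A y \<subseteq> S"
proof
  fix g assume g: "g \<in> centralizer_in A y"
  show "g \<in> S"
  proof (rule ccontr)
    assume gS: "g \<notin> S"
    have gA: "g \<in> A" "g \<otimes> y = y \<otimes> g" using g by (auto simp: centralizer_in_def)
    have "comm g y = \<one>" using comm_eq_one gA y index_pD[OF S] A subgroup_carrier by metis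
    then have "comm g y \<in> derived G S" using derived_subgroup index_pD[OF S] subgroup.one_closed by metis
    then show False using centre_mod_iff[OF A S gA(1) gS y(1)] y(2) by blast
  qed
qed


text \<open>\<open>A'\<close> consists of the products \<open>comm x s \<otimes> l\<close> with \<open>s \<in> S\<close>, \<open>l \<in> S'\<close> for a fixed \<open>x \<in> A \<setminus> S\<close>,
  and \<open>s \<mapsto> comm x s\<close> is a homomorphism modulo \<open>S'\<close>.\<close>

lemma card_derived_index_p:
  assumes A: "subgroup A G" and S: "index_p A S"
  shows "card (derived G A) * card (centre_mod A S) = card (derived G S) * card S"
proof -
  let ?L = "derived G S" and ?T = "centre_mod A S"
  obtain x where x: "x \<in> A" "x \<notin> S" using index_p_proper[OF S] by blast
  note S' = index_pD(1)[OF S] and SA = index_pD(2)[OF S]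
  have L: "subgroup ?L G" by (rule derived_subgroup[OF S'])
  have LS: "?L \<subseteq> S" by (rule derived_sub[OF S'])
  have T: "subgroup ?T G" by (rule centre_mod_subgroup[OF A S])
  have cA: "a \<in> carrier G" if "a \<in> A" for a using that A subgroup_carrier by blast
  have cS: "s \<in> carrier G" if "s \<in> S" for s using that S' subgroup_carrier by blast
  have cL: "s \<in> carrier G" if "s \<in> ?L" for s using that L subgroup_carrier by blast
  have xc: "x \<in> carrier G" using x cA by blast
  note Lconj = index_p_derived_conj[OF A S]
  note Lm = subgroup.m_closed[OF L] and Li = subgroup.m_inv_closed[OF L]
  note Sm = subgroup.m_closed[OF S'] and Si = subgroup.m_inv_closed[OF S']
  have comS: "comm x s \<in> S" if "s \<in> S" for s
    unfolding comm_def by (rule Sm[OF index_p_conj[OF A S x(1) that] Si[OF that]])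
  let ?f = "\<lambda>(s, l). comm x s \<otimes> l"
  define P where "P = ?f ` (S \<times> ?L)"
  have PI: "comm x s \<otimes> l \<in> P" if "s \<in> S" "l \<in> ?L" for s l
    unfolding P_def using that by (intro image_eqI[of _ _ "(s, l)"]) auto
  have PE: "\<exists>s l. s \<in> S \<and> l \<in> ?L \<and> y = comm x s \<otimes> l" if "y \<in> P" for y
    using that by (auto simp: P_def)
  have LP: "?L \<subseteq> P"
  proof
    fix l assume l: "l \<in> ?L"
    have "comm x \<one> \<otimes> l \<in> P" using l S' by (intro PI) (simp_all add: subgroup.one_closed)
    then show "l \<in> P" using l cL xc by (simp add: comm_def)
  qed
  have comP: "comm x s \<in> P" if "s \<in> S" for s
    using PI[OF that subgroup.one_closed[OF L]] that xc cS by simp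
  have P: "subgroup P G"
  proof (rule subgroupI)
    show "P \<subseteq> carrier G" using xc cS cL by (auto simp: P_def)
    show "P \<noteq> {}" using LP L subgroup.one_closed by blast
    fix y assume "y \<in> P"
    then obtain s l where y: "s \<in> S" "l \<in> ?L" "y = comm x s \<otimes> l" using PE by blast
    let ?c = "comm x s"
    have c: "?c \<in> S" "?c \<in> carrier G" "s \<in> carrier G" "l \<in> carrier G" using comS y cS cL xc by auto
    \<comment> \<open>Modulo S' the inverse of comm x s is comm x (s^-1); this element of S' is the
      exact correction. Products and conjugates below follow the same pattern.\<close>
    have "comm (inv s) ?c \<otimes> (?c \<otimes> inv l \<otimes> inv ?c) \<in> ?L"
      using Lm[OF comm_derived[OF Si[OF y(1)] c(1)] Lconj[OF subsetD[OF SA c(1)] Li[OF y(2)]]] .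
    from PI[OF Si[OF y(1)] this]
    have "comm x (inv s) \<otimes> (comm (inv s) ?c \<otimes> (?c \<otimes> inv l \<otimes> inv ?c)) \<in> P" .
    moreover have "comm x (inv s) \<otimes> (comm (inv s) ?c \<otimes> (?c \<otimes> inv l \<otimes> inv ?c)) = inv y"
      unfolding y(3) using c xc by (simp add: comm_def word)
    ultimately show "inv y \<in> P" by simp
    fix z assume "z \<in> P"
    then obtain t m where z: "t \<in> S" "m \<in> ?L" "z = comm x t \<otimes> m" using PE by blast
    let ?d = "comm x t"
    have d: "?d \<in> S" "?d \<in> carrier G" "t \<in> carrier G" "m \<in> carrier G" using comS z cS cL xc by auto
    have "inv ?d \<otimes> l \<otimes> inv (inv ?d) \<in> ?L" using Lconj[of "inv ?d" l] d y Si SA by blast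
    then have "comm s (inv ?d) \<otimes> (inv ?d \<otimes> l \<otimes> inv (inv ?d)) \<otimes> m \<in> ?L"
      using Lm[OF Lm[OF comm_derived[OF y(1) Si[OF d(1)]]] z(2)] by blast
    from PI[OF Sm[OF y(1) z(1)] this]
    have "comm x (s \<otimes> t) \<otimes> (comm s (inv ?d) \<otimes> (inv ?d \<otimes> l \<otimes> inv (inv ?d)) \<otimes> m) \<in> P" .
    moreover have "comm x (s \<otimes> t) \<otimes> (comm s (inv ?d) \<otimes> (inv ?d \<otimes> l \<otimes> inv (inv ?d)) \<otimes> m) = y \<otimes> z"
      unfolding y(3) z(3) using c d xc by (simp add: comm_def word)
    ultimately show "y \<otimes> z \<in> P" by simp
  qed
  note cP = subgroup_carrier[OF P]
  let ?N = "{a \<in> A. \<forall>y\<in>P. a \<otimes> y \<otimes> inv a \<in> P}"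
  have "A \<subseteq> ?N"
  proof (rule index_p_maximal[OF A S normalizer_subgroup[OF P A] _ _ x])
    have "s \<otimes> y \<otimes> inv s \<in> P" if s: "s \<in> S" and yP: "y \<in> P" for s y
    proof -
      obtain t m where y: "t \<in> S" "m \<in> ?L" "y = comm x t \<otimes> m" using PE yP by blast
      let ?d = "comm x t"
      have d: "?d \<in> S" "?d \<in> carrier G" "t \<in> carrier G" "m \<in> carrier G" "s \<in> carrier G"
        using comS y cS cL xc s by auto
      have "comm (inv ?d) s \<otimes> (s \<otimes> m \<otimes> inv s) \<in> ?L"
        using Lm[OF comm_derived[OF Si[OF d(1)] s] Lconj[OF subsetD[OF SA s] y(2)]] .
      from PI[OF y(1) this] show ?thesis
        unfolding y(3) using d xc by (simp add: comm_def word)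
    qed
    then show "S \<subseteq> ?N" using SA by blast
    have "x \<otimes> y \<otimes> inv x \<in> P" if yP: "y \<in> P" for y
    proof -
      obtain t m where y: "t \<in> S" "m \<in> ?L" "y = comm x t \<otimes> m" using PE yP by blast
      have d: "t \<in> carrier G" "m \<in> carrier G" using y cS cL by auto
      have "comm x (x \<otimes> t \<otimes> inv x) \<otimes> (x \<otimes> m \<otimes> inv x) \<in> P"
        by (rule PI[OF index_p_conj[OF A S x(1) y(1)] Lconj[OF x(1) y(2)]])
      then show ?thesis unfolding y(3) using d xc by (simp add: comm_def word)
    qed
    then show "x \<in> ?N" using x by blast
  qed
  then have Pconj: "a \<otimes> y \<otimes> inv a \<in> P" if "a \<in> A" "y \<in> P" for a y using that by blast
  \<comment> \<open>As \<open>P\<close> is normalized by \<open>A\<close>, the \<open>a\<close> with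
    \<open>comm a b\<close> in \<open>P\<close> form a subgroup, so \<open>S\<close> and
    \<open>x\<close> suffice as tests. This is applied to \<open>b\<close> in \<open>S\<close>, then
    to \<open>x\<close>, then to every \<open>b\<close>.\<close>
  have gen: "comm a b \<in> P" if b: "b \<in> A" and "comm x b \<in> P" "\<And>s. s \<in> S \<Longrightarrow> comm s b \<in> P" "a \<in> A" for a b
  proof -
    have "subgroup {a \<in> A. comm a b \<in> P} G" by (rule comm_mod_subgroup[OF A P Pconj cA[OF b]])
    then have "A \<subseteq> {a \<in> A. comm a b \<in> P}" using index_p_maximal[OF A S _ _ _ x] that SA x by blast
    then show ?thesis using that by blast
  qed
  have comSP: "comm s t \<in> P" if "s \<in> S" "t \<in> S" for s t using comm_derived[OF that] LP by blast
  have 1: "comm a s \<in> P" if "a \<in> A" "s \<in> S" for a s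
    by (rule gen[OF subsetD[OF SA that(2)] comP[OF that(2)] comSP[OF _ that(2)] that(1)])
  have 2: "comm a x \<in> P" if "a \<in> A" for a
  proof (rule gen[OF x(1) _ _ that])
    have "comm x x = \<one>" using xc by (simp add: comm_def word)
    then show "comm x x \<in> P" using P subgroup.one_closed by metis
    show "comm s x \<in> P" if "s \<in> S" for s 
      by (rule comm_swap_in[OF P xc cS[OF that] 1[OF x(1) that]])
  qed
  have "comm a b \<in> P" if "a \<in> A" "b \<in> A" for a b
  proof (rule gen[OF that(2) _ _ that(1)])
    show "comm x b \<in> P" 
      by (rule comm_swap_in[OF P cA[OF that(2)] xc 2[OF that(2)]])
    show "comm s b \<in> P" if "s \<in> S" for s 
      by (rule comm_swap_in[OF P cA[OF \<open>b \<in> A\<close>] cS[OF that] 1[OF \<open>b \<in> A\<close> that]])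
  qed
  then have "derived G A \<subseteq> P" by (rule derived_least[OF P])
  moreover have "P \<subseteq> derived G A"
  proof
    fix y assume "y \<in> P"
    then obtain s l where "s \<in> S" "l \<in> ?L" "y = comm x s \<otimes> l" using PE by blast
    then show "y \<in> derived G A"
      using comm_derived[of x A s] x SA mono_derived[OF SA] subgroup.m_closed[OF derived_subgroup[OF A]] by blast
  qed
  ultimately have PA: "P = derived G A" by blast
  \<comment> \<open>Pairs with the same image have first entries differing by some \<open>t\<close>
    with \<open>comm x t\<close> in S', that is, by an element of T.\<close>
  have "card {z \<in> S \<times> ?L. ?f z = y} = card ?T" if yP: "y \<in> ?f ` (S \<times> ?L)" for y
  proof -
    obtain s l where y: "s \<in> S" "l \<in> ?L" "y = comm x s \<otimes> l" using yP by auto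
    have c: "s \<in> carrier G" "l \<in> carrier G" using y cS cL by auto
    let ?g = "\<lambda>t. (s \<otimes> t, s \<otimes> inv (comm x t) \<otimes> inv s \<otimes> l)"
    have "{z \<in> S \<times> ?L. ?f z = y} = ?g ` ?T"
    proof (intro equalityI subsetI)
      fix z assume "z \<in> {z \<in> S \<times> ?L. ?f z = y}"
      then obtain r m where z: "z = (r, m)" "r \<in> S" "m \<in> ?L" "comm x r \<otimes> m = y" by auto
      have rc: "r \<in> carrier G" "m \<in> carrier G" using z cS cL by auto
      let ?t = "inv s \<otimes> r"
      have t: "?t \<in> S" "?t \<in> carrier G" using y z Sm Si cS by auto
      have r: "r = s \<otimes> ?t" using c rc by simp
      have e: "comm x r = comm x s \<otimes> (s \<otimes> comm x ?t \<otimes> inv s)" using xc c rc by (simp add: comm_def word)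
      then have "comm x s \<otimes> ((s \<otimes> comm x ?t \<otimes> inv s) \<otimes> m) = comm x s \<otimes> l"
        using z y xc c rc t by (simp add: m_assoc)
      then have e2: "(s \<otimes> comm x ?t \<otimes> inv s) \<otimes> m = l" using xc c rc t by simp
      then have "comm x ?t = inv s \<otimes> (l \<otimes> inv m) \<otimes> inv (inv s)"
        using xc c rc t by (auto simp: word)
      also have "\<dots> \<in> ?L" by (rule Lconj[OF subsetD[OF SA Si[OF y(1)]] Lm[OF y(2) Li[OF z(3)]]])
      finally have tT: "?t \<in> ?T" using centre_mod_iff[OF A S x t(1)] by blast
      have "m = s \<otimes> inv (comm x ?t) \<otimes> inv s \<otimes> l"
        unfolding e2[symmetric] using xc c rc t by (simp add: word)
      then have "z = ?g ?t" using z r by simp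
      then show "z \<in> ?g ` ?T" using tT by blast
    next
      fix z assume "z \<in> ?g ` ?T"
      then obtain t where t: "t \<in> ?T" "z = ?g t" by blast
      have tS: "t \<in> S" "t \<in> carrier G" using t centre_mod_sub cS by blast+
      have "comm x t \<in> ?L" using centre_mod_iff[OF A S x tS(1)] t by blast
      then have "s \<otimes> inv (comm x t) \<otimes> inv s \<otimes> l \<in> ?L" 
        using Lm[OF Lconj[OF subsetD[OF SA y(1)] Li] y(2)] by blast
      moreover have "comm x (s \<otimes> t) \<otimes> (s \<otimes> inv (comm x t) \<otimes> inv s \<otimes> l) = y"
        unfolding y(3) using xc c tS by (simp add: comm_def word)
      ultimately show "z \<in> {z \<in> S \<times> ?L. ?f z = y}" using t y tS Sm by simp
    qed
    moreover have "inj_on ?g ?T" using c centre_mod_sub cS by (auto simp: inj_on_def subset_iff)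
    ultimately show ?thesis by (simp add: card_image)
  qed
  then have "card (S \<times> ?L) = card ?T * card P"
    unfolding P_def using S' L subgroup_finite by (intro card_eq_fibers) auto
  then show ?thesis using PA by (simp add: card_cartesian_product mult.commute)
qed

section \<open>Breadth in subgroups\<close>

lemma centralizer_in_subgroup:
  assumes A: "subgroup A G" and x: "x \<in> carrier G"
  shows "subgroup (centralizer_in A x) G"
proof -
  have "centralizer_in A x = {a \<in> A. comm a x \<in> {\<one>}}"
    using comm_eq_one subgroup_carrier[OF A] x by (auto simp: centralizer_in_def)
  moreover have "subgroup {a \<in> A. comm a x \<in> {\<one>}} G"
    by (rule comm_mod_subgroup[OF A triv_subgroup]) (use A x subgroup_carrier in auto)
  ultimately show ?thesis by simp
qed

lemma centralizer_in_inter: "S \<subseteq> A \<Longrightarrow> centralizer_in A x \<inter> S = centralizer_in S x" by (auto simp: centralizer_in_def)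

lemma centralizer_in_sub: "centralizer_in A x \<subseteq> A" by (auto simp: centralizer_in_def)

lemma centralizer_in_self: "x \<in> A \<Longrightarrow> x \<in> centralizer_in A x" by (simp add: centralizer_in_def)

text \<open>|S : C_S(x)| <= |A : C_A(x)|, because C_S(x) is the intersection of \<open>S\<close>
  with C_A(x).\<close>

lemma breadth_mono:
  assumes A: "subgroup A G" and S: "subgroup S G" "S \<subseteq> A" and x: "x \<in> carrier G"
    and b: "card A \<le> p ^ m * card (centralizer_in A x)"
  shows "card S \<le> p ^ m * card (centralizer_in S x)"
proof -
  have "card (centralizer_in A x) * card S \<le> card A * card (centralizer_in S x)"
    using card_inter[OF centralizer_in_subgroup[OF A x] S(1) A centralizer_in_sub S(2)] centralizer_in_inter[OF S(2)] by simp
  also have "\<dots> \<le> p ^ m * card (centralizer_in A x) * card (centralizer_in S x)" using b by simp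
  finally have "card (centralizer_in A x) * card S \<le> card (centralizer_in A x) * (p ^ m * card (centralizer_in S x))" by (simp add: ac_simps)
  then show ?thesis using subgroup_card_pos[OF centralizer_in_subgroup[OF A x]] by simp
qed

text \<open>The centralizer stays the same while the group shrinks by the factor \<open>p\<close>;
  \<open>m = 0\<close> would force \<open>A\<close> into \<open>S\<close>.\<close>

lemma breadth_drop:
  assumes A: "subgroup A G" and S: "index_p A S" and x: "x \<in> S" and sub: "centralizer_in A x \<subseteq> S"
    and b: "card A \<le> p ^ m * card (centralizer_in A x)"
  shows "m > 0 \<and> card S \<le> p ^ (m - 1) * card (centralizer_in S x)"
proof -
  have eq: "centralizer_in S x = centralizer_in A x" using sub index_pD(2)[OF S] by (auto simp: centralizer_in_def)
  have "m \<noteq> 0"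
  proof
    assume "m = 0"
    then have "card A \<le> card S" using b card_mono[OF subgroup_finite[OF index_pD(1)[OF S]] sub] by simp
    then show False using psubset_card_mono[OF subgroup_finite[OF A] index_p_proper[OF S]] by simp
  qed
  moreover from this have "p * card S \<le> p * (p ^ (m - 1) * card (centralizer_in S x))"
    using b index_pD(3)[OF S] eq by (cases m) (simp_all add: ac_simps)
  ultimately show ?thesis using p_ge2 by simp
qed

lemma breadth_drop_outside_centre_mod:
  assumes "subgroup A G" "index_p A S" "x \<in> S" "x \<notin> centre_mod A S" "card A \<le> p ^ m * card (centralizer_in A x)"
  shows "m > 0 \<and> card S \<le> p ^ (m - 1) * card (centralizer_in S x)"
  using assms by (intro breadth_drop centralizer_in_sub_if_not_centre_mod)

lemma centralizer_in_sub_centre_mod: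
  assumes A: "subgroup A G" and S: "index_p A S" and x: "x \<in> A" "x \<notin> S"
  shows "centralizer_in S x \<subseteq> centre_mod A S"
proof
  fix s assume s: "s \<in> centralizer_in S x"
  then have "s \<in> S" "s \<otimes> x = x \<otimes> s" by (auto simp: centralizer_in_def)
  then have "comm x s = \<one>" using comm_eq_one x A index_pD(1)[OF S] subgroup_carrier by metis
  then show "s \<in> centre_mod A S" using centre_mod_iff[OF A S x \<open>s \<in> S\<close>] derived_subgroup[OF index_pD(1)[OF S]] subgroup.one_closed by metis
qed

text \<open>|A' : S'| = |S : T| by \<open>card_derived_index_p\<close>, and T contains the
  centralizer in \<open>S\<close> of any element of \<open>A\<close> outside
  \<open>S\<close>.\<close>

lemma card_derived_le:
  assumes A: "subgroup A G" and S: "index_p A S" and x: "x \<in> A" "x \<notin> S"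
    and b: "card S \<le> p ^ m * card (centralizer_in S x)"
  shows "card S \<le> p ^ m * card (centre_mod A S)" "card (derived G A) \<le> p ^ m * card (derived G S)"
proof -
  have T: "subgroup (centre_mod A S) G" by (rule centre_mod_subgroup[OF A S])
  have "card (centralizer_in S x) \<le> card (centre_mod A S)"
    by (rule card_mono[OF subgroup_finite[OF T] centralizer_in_sub_centre_mod[OF A S x]])
  then show c: "card S \<le> p ^ m * card (centre_mod A S)" using b by (meson le_trans mult_le_mono2)
  have "card (centre_mod A S) * card (derived G A) = card (derived G S) * card S"
    using card_derived_index_p[OF A S] by (simp add: mult.commute)
  also have "\<dots> \<le> card (derived G S) * (p ^ m * card (centre_mod A S))" using c by simp
  finally have "card (centre_mod A S) * card (derived G A) \<le> card (centre_mod A S) * (p ^ m * card (derived G S))"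
    by (simp add: ac_simps)
  then show "card (derived G A) \<le> p ^ m * card (derived G S)" using subgroup_card_pos[OF T] by simp
qed

end

text \<open>Exponent bookkeeping for one induction step: \<open>m\<close> from |A' : S'| plus the
  bound for \<open>m - 1\<close> on S'.\<close>

lemma triangle_pred: "m > 0 \<Longrightarrow> m + (m - 1) * (m - 1 + 1) div 2 = m * (m + 1) div (2::nat)"
  by (cases m) (auto simp: algebra_simps)

section \<open>Pencils of subgroups of index p, and coverings\<close>

context finite_p_group
begin

lemma index_p_inter:
  assumes A: "subgroup A G" and P: "index_p A P" and Q: "index_p A Q" and ne: "P \<noteq> Q"
  shows "card P = p * card (P \<inter> Q)"
proof -
  note P' = index_pD[OF P] and Q' = index_pD[OF Q]
  have "card P = card Q" using P' Q' p_ge2 by simp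
  then have "P \<inter> Q \<subset> P" using ne card_seteq[OF subgroup_finite[OF Q'(1)], of P] by auto
  then have "p * card (P \<inter> Q) \<le> card P" using proper_card subgroup_inter P' Q' by blast
  moreover have "card P * card Q \<le> p * card Q * card (P \<inter> Q)"
    using card_inter[OF P'(1) Q'(1) A P'(2) Q'(2)] Q'(3) by simp
  then have "card Q * card P \<le> card Q * (p * card (P \<inter> Q))" by (simp add: ac_simps)
  then have "card P \<le> p * card (P \<inter> Q)" using subgroup_card_pos[OF Q'(1)] by simp
  ultimately show ?thesis by simp
qed

lemma index_p_subset_eq:
  assumes "index_p A P" "index_p A Q" "P \<subseteq> Q" shows "P = Q"
  using assms card_subset_eq[OF subgroup_finite, of Q P] p_ge2 by (auto simp: index_p_def)

text \<open>\<open>S \<inter> P\<close> has the same order as \<open>P \<inter> Q\<close> and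
  contains it.\<close>

lemma index_p_pencil_inter:
  assumes A: "subgroup A G" and P: "index_p A P" and Q: "index_p A Q" and ne: "P \<noteq> Q"
    and S: "index_p A S" "P \<inter> Q \<subseteq> S" "S \<noteq> P"
  shows "S \<inter> P = P \<inter> Q"
proof -
  have "card S = p * card (S \<inter> P)" by (rule index_p_inter[OF A S(1) P S(3)])
  moreover have "card S = card P" using index_pD(3)[OF S(1)] index_pD(3)[OF P] p_ge2 by simp
  ultimately have "card (P \<inter> Q) = card (S \<inter> P)" using index_p_inter[OF A P Q ne] p_ge2 by simp
  moreover have "finite (S \<inter> P)" using subgroup_finite[OF index_pD(1)[OF P]] by simp
  ultimately show ?thesis using card_subset_eq[of "S \<inter> P" "P \<inter> Q"] S(2) by auto
qed

text \<open>\<open>k\<close> is prime to the order of the group, so a Bezout relation makes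
  \<open>a\<close> a power of \<open>a [^] k\<close>.\<close>

lemma in_subgroup_if_power:
  assumes S: "subgroup S G" and a: "a \<in> carrier G" and k: "a [^] (k::int) \<in> S" "\<not> int p dvd k"
  shows "a \<in> S"
proof -
  obtain e where e: "card (carrier G) = p ^ e" using card_G by blast
  have "Factorial_Ring.prime (int p)" using prime_p by simp
  then have "coprime k (int p)" using k(2) prime_imp_coprime coprime_commute by blast
  then have "coprime k (int p ^ e)" by simp
  then obtain u v where uv: "u * k + v * int p ^ e = 1" using bezout_int[of k "int p ^ e"] by auto
  have "a [^] (int p ^ e) = \<one>"
    using pow_order_eq_1[OF a] e by (simp add: order_def flip: int_pow_int of_nat_power)
  then have v1: "a [^] (v * int p ^ e) = \<one>"
    using int_pow_pow[OF a, of "int p ^ e" v] by (simp add: mult.commute)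
  have "a = a [^] (u * k + v * int p ^ e)" using uv a by simp
  also have "\<dots> = a [^] (u * k)" using v1 a by (simp add: int_pow_mult)
  also have "\<dots> = (a [^] k) [^] u" using a by (simp add: int_pow_pow mult.commute)
  also have "\<dots> \<in> S" using subgroup_int_pow_closed[OF S k(1)] .
  finally show ?thesis .
qed

text \<open>Instead of using the quotient by \<open>S\<close>, orders are compared inside the cyclic
  group of \<open>a\<close>: its intersection with \<open>S\<close> lies in the group generated by
  \<open>a [^] p\<close> and is at least as large.\<close>

lemma index_p_pth_power:
  assumes A: "subgroup A G" and S: "index_p A S" and a: "a \<in> A"
  shows "a [^] p \<in> S"
proof (cases "a \<in> S")
  case True
  then show ?thesis using subgroup_int_pow_closed[OF index_pD(1)[OF S], of a "int p"] by (simp add: int_pow_int)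
next
  case False
  note S' = index_pD[OF S]
  have ac: "a \<in> carrier G" using a A subgroup_carrier by blast
  let ?C = "generate G {a}" and ?U = "generate G {a [^] p}"
  have C: "subgroup ?C G" and U: "subgroup ?U G" using ac by (simp_all add: generate_is_subgroup)
  have aC: "a \<in> ?C" by (rule generate.incl) simp
  have CA: "?C \<subseteq> A" using a A by (intro generate_subgroup_incl) auto
  have "a [^] p \<in> ?C" using subgroup_int_pow_closed[OF C aC, of "int p"] by (simp add: int_pow_int)
  then have UC: "?U \<subseteq> ?C" using C by (intro generate_subgroup_incl) auto
  have Ue: "?U = {a [^] (int p * j) | j. True}"
    using generate_pow[of "a [^] p"] ac by (auto simp: int_pow_pow simp flip: int_pow_int)
  have "a \<notin> ?U"
  proof
    assume "a \<in> ?U"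
    then obtain j where "a = a [^] (int p * j)" using Ue by blast
    then have "a [^] (1 - int p * j) = \<one>" using ac by (simp add: int_pow_diff r_inv)
    then have "a [^] (1 - int p * j) \<in> S" using S' subgroup.one_closed by metis
    moreover have "\<not> int p dvd 1 - int p * j"
      using p_ge2 by (metis dvd_add_right_iff dvd_triv_left diff_add_cancel add.commute int_dvd_int_iff nat_dvd_1_iff_1 of_nat_1 One_nat_def not_less_eq_eq numeral_2_eq_2 order_refl)
    ultimately show False using in_subgroup_if_power[OF S'(1) ac] False by blast
  qed
  then have "p * card ?U \<le> card ?C" using UC aC by (intro proper_card U C) blast
  also have "card S * card ?C \<le> card S * (p * card (?C \<inter> S))"
    using card_inter[OF C S'(1) A CA S'(2)] S'(3) by (simp add: ac_simps)
  then have "card ?C \<le> p * card (?C \<inter> S)" using subgroup_card_pos[OF S'(1)] by simp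
  finally have "card ?U \<le> card (?C \<inter> S)" using p_ge2 by simp
  moreover have "?C \<inter> S \<subseteq> ?U"
  proof
    fix c assume c: "c \<in> ?C \<inter> S"
    then obtain k :: int where k: "c = a [^] k" using generate_pow[OF ac] by blast
    then have "int p dvd k" using in_subgroup_if_power[OF S'(1) ac, of k] c False by blast
    then show "c \<in> ?U" using k Ue by (auto elim: dvdE)
  qed
  ultimately have "?C \<inter> S = ?U" using card_seteq[OF subgroup_finite[OF U]] by blast
  moreover have "a [^] p \<in> ?U" by (rule generate.incl) simp
  ultimately show ?thesis by blast
qed

text \<open>\<open>a [^] p\<close> lies in \<open>P \<inter> Q\<close>, so adjoining
  \<open>a\<close> gives a subgroup of order at most \<open>card P\<close>; being proper, it extends
  to one of index \<open>p\<close>.\<close>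

lemma index_p_pencil:
  assumes A: "subgroup A G" and P: "index_p A P" and Q: "index_p A Q" and ne: "P \<noteq> Q" and a: "a \<in> A"
  shows "\<exists>S. index_p A S \<and> P \<inter> Q \<subseteq> S \<and> a \<in> S"
proof -
  let ?R = "P \<inter> Q" and ?C = "generate G {a}"
  note P' = index_pD[OF P] and Q' = index_pD[OF Q]
  have ac: "a \<in> carrier G" using a A subgroup_carrier by blast
  have R: "subgroup ?R G" using P' Q' subgroup_inter by blast
  have C: "subgroup ?C G" using ac by (simp add: generate_is_subgroup)
  have CA: "?C \<subseteq> A" using a A by (intro generate_subgroup_incl) auto
  have aC: "a \<in> ?C" by (rule generate.incl) simp
  have N: "subgroup (?R <#> ?C) G"
    using index_p_conj[OF A P] index_p_conj[OF A Q] CA by (intro subgroup_set_mult R C) blast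
  have NA: "?R <#> ?C \<subseteq> A"
    using P' CA A by (auto simp: set_mult_def subset_iff subgroup.m_closed)
  have "a [^] p \<in> ?R" using index_p_pth_power[OF A P a] index_p_pth_power[OF A Q a] by blast
  then have "card ?C \<le> p * card (?R \<inter> ?C)" by (rule card_generate_le[OF R ac])
  then have "card ?R * card ?C \<le> card (?R \<inter> ?C) * (p * card ?R)" by (simp add: ac_simps)
  then have "card (?R \<inter> ?C) * card (?R <#> ?C) \<le> card (?R \<inter> ?C) * (p * card ?R)"
    using card_set_mult[OF R C] by simp
  then have "card (?R <#> ?C) \<le> card P"
    using subgroup_card_pos[OF subgroup_inter[OF R C]] index_p_inter[OF A P Q ne] by simp
  then have "?R <#> ?C \<subset> A" using NA psubset_card_mono[OF subgroup_finite[OF A] index_p_proper[OF P]] by auto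
  then obtain S where "index_p A S" "?R <#> ?C \<subseteq> S" using index_p_exists[OF N A] by blast
  then show ?thesis using set_mult_incl[OF R C] aC by blast
qed

text \<open>Each member of \<open>\<H>\<close> shares \<open>q\<close> elements with
  \<open>H0\<close> and thus adds at most \<open>(p - 1) * q\<close> new ones.\<close>

lemma card_union_index_p:
  assumes A: "subgroup A G" and fin: "finite \<H>" and H0: "index_p A H0" and q: "card A = p\<^sup>2 * q"
    and H: "\<And>H. H \<in> \<H> \<Longrightarrow> index_p A H" and notin: "H0 \<notin> \<H>"
  shows "card (H0 \<union> \<Union>\<H>) \<le> (Suc (card \<H>) * (p - 1) + 1) * q"
  using fin H notin
proof (induction \<H> rule: finite_induct)
  case empty
  have "card H0 = p * q" using index_pD(3)[OF H0] q p_ge2 by (simp add: power2_eq_square)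
  then show ?case using p_ge2 by (simp add: algebra_simps)
next
  case (insert H \<H>)
  have H: "index_p A H" "H \<noteq> H0" using insert.prems by auto
  have "card H = p * q" using index_pD(3)[OF H(1)] q p_ge2 by (simp add: power2_eq_square)
  then have "card (H \<inter> H0) = q" using index_p_inter[OF A H(1) H0 H(2)] p_ge2 by simp
  then have d: "card (H - H0) = p * q - q"
    using \<open>card H = p * q\<close> subgroup_finite[OF index_pD(1)[OF H(1)]] by (simp add: card_Diff_subset_Int)
  have "H0 \<union> \<Union>(insert H \<H>) = (H0 \<union> \<Union>\<H>) \<union> (H - H0)" by blast
  then have "card (H0 \<union> \<Union>(insert H \<H>)) \<le> card (H0 \<union> \<Union>\<H>) + card (H - H0)"
    by (metis card_Un_le)
  also have "\<dots> \<le> (Suc (card \<H>) * (p - 1) + 1) * q + (p * q - q)"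
    using insert by (simp add: d)
  also have "p * q - q = (p - 1) * q" by (simp add: diff_mult_distrib)
  finally show ?case using insert.hyps by (simp add: algebra_simps)
qed

text \<open>With \<open>card A = p\<^sup>2 * q\<close>, the family covers at most
  \<open>(p * (p - 1) + 1) * q\<close> elements, and \<open>J\<close> adds fewer than
  \<open>q\<close>.\<close>

lemma index_p_no_cover:
  assumes A: "subgroup A G" and fin: "finite \<H>" and le: "card \<H> \<le> p"
    and H: "\<And>H. H \<in> \<H> \<Longrightarrow> index_p A H" and J: "subgroup J G" "p\<^sup>2 * card J \<le> card A"
  shows "\<exists>x\<in>A. x \<notin> \<Union>\<H> \<and> x \<notin> J"
proof (rule ccontr)
  assume no: "\<not> ?thesis"
  obtain i j where ij: "card A = p ^ i" "card J = p ^ j" using subgroup_card A J by blast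
  have "p ^ (2 + j) \<le> p ^ i" using J(2) ij by (simp only: power_add)
  then have "2 + j \<le> i" by (rule power_le_imp_le_exp[rotated]) (use p_ge2 in simp)
  then have "i = 2 + (i - 2)" by simp
  then have q: "card A = p\<^sup>2 * p ^ (i - 2)" using ij(1) power_add by metis
  define q where "q = p ^ (i - 2)"
  have qpos: "q > 0" and q: "card A = p\<^sup>2 * q" using q p_ge2 by (simp_all add: q_def)
  have Jq: "card J \<le> q" using J q p_ge2 by simp
  have sub: "A \<subseteq> \<Union>\<H> \<union> J" using no by blast
  show False
  proof (cases "\<H> = {}")
    case True
    then have "card A \<le> card J" using sub card_mono[OF subgroup_finite[OF J(1)]] by simp
    then have "p\<^sup>2 * q \<le> q" using Jq q by linarith
    moreover have "1 < p\<^sup>2" using p_ge2 by (intro one_less_power) auto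
    then have "1 * q < p\<^sup>2 * q" using qpos by (rule mult_strict_right_mono)
    ultimately show False by simp
  next
    case False
    then obtain H0 where H0: "H0 \<in> \<H>" by blast
    have fU: "finite (\<Union>\<H>)" by (rule finite_Union[OF fin]) (use H index_pD(1) subgroup_finite in blast)
    have "\<Union>\<H> = H0 \<union> \<Union>(\<H> - {H0})" using H0 by blast
    then have "card (\<Union>\<H>) \<le> (Suc (card (\<H> - {H0})) * (p - 1) + 1) * q"
      using card_union_index_p[OF A _ H[OF H0] q, of "\<H> - {H0}"] fin H by simp
    also have "Suc (card (\<H> - {H0})) = card \<H>" by (rule card_Suc_Diff1[OF fin H0])
    also have "(card \<H> * (p - 1) + 1) * q \<le> (p * (p - 1) + 1) * q" using le by simp
    finally have U: "card (\<Union>\<H>) \<le> (p * (p - 1) + 1) * q" .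
    \<comment> \<open>For \<open>p = 2\<close> the estimate is tight; strictness comes from counting
      \<open>\<one>\<close> only once.\<close>
    have "\<one> \<in> \<Union>\<H>" using H0 H[OF H0] index_pD subgroup.one_closed by blast
    then have "A \<subseteq> \<Union>\<H> \<union> (J - {\<one>})" using sub by blast
    then have "card A \<le> card (\<Union>\<H> \<union> (J - {\<one>}))"
      using fU subgroup_finite[OF J(1)] by (intro card_mono) auto
    also have "\<dots> \<le> card (\<Union>\<H>) + card (J - {\<one>})" by (rule card_Un_le)
    also have "card (J - {\<one>}) = card J - 1" 
      by (rule card_Diff_singleton[OF subgroup.one_closed[OF J(1)]])
    finally have "p\<^sup>2 * q \<le> (p * (p - 1) + 1) * q + (q - 1)" using U Jq q by linarith
    also have "\<dots> < (p * (p - 1) + 2) * q" using qpos by (simp add: algebra_simps)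
    also have "\<dots> \<le> p\<^sup>2 * q"
    proof -
      obtain r where "p = r + 2" using p_ge2 by (metis add.commute le_Suc_ex)
      then have "p * (p - 1) + 2 \<le> p\<^sup>2" by (simp add: power2_eq_square algebra_simps)
      then show ?thesis by (rule mult_le_mono1)
    qed
    finally show False by simp
  qed
qed

definition commuting :: "'a set \<Rightarrow> bool" where
  "commuting A \<longleftrightarrow> (\<forall>x\<in>A. \<forall>y\<in>A. x \<otimes> y = y \<otimes> x)"

lemma commuting_derived:
  assumes A: "subgroup A G" and ab: "commuting A" shows "card (derived G A) = 1"
proof -
  have "derived G A \<subseteq> {\<one>}"
    using A ab comm_eq_one subgroup_carrier[OF A] by (intro derived_least triv_subgroup) (auto simp: commuting_def)
  then have "derived G A = {\<one>}" using derived_subgroup[OF A] subgroup.one_closed by blast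
  then show ?thesis by simp
qed

text \<open>\<open>x\<close> lies in a proper centralizer: its own or, if \<open>x\<close> is
  central in \<open>A\<close>, that of any noncentral element.\<close>

lemma not_commuting_index_p:
  assumes A: "subgroup A G" and ab: "\<not> commuting A" and x: "x \<in> A"
  shows "\<exists>S. index_p A S \<and> x \<in> S"
proof -
  have c: "a \<in> carrier G" if "a \<in> A" for a using that A subgroup_carrier by blast
  have "\<exists>y\<in>A. x \<in> centralizer_in A y \<and> centralizer_in A y \<noteq> A"
  proof (cases "centralizer_in A x = A")
    case True
    obtain y where y: "y \<in> A" "centralizer_in A y \<noteq> A" using ab by (auto simp: commuting_def centralizer_in_def)
    have "y \<in> centralizer_in A x" using True y by simp
    then have "x \<in> centralizer_in A y" using x by (simp add: centralizer_in_def)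
    then show ?thesis using y by blast
  next
    case False then show ?thesis using x centralizer_in_self by blast
  qed
  then obtain y where "y \<in> A" "x \<in> centralizer_in A y" "centralizer_in A y \<noteq> A" by blast
  then show ?thesis using index_p_exists[OF centralizer_in_subgroup[OF A c] A] centralizer_in_sub by blast
qed

text \<open>The chain from the trivial group through the centralizer of a noncentral
  \<open>x\<close> to \<open>A\<close> is strict in both steps.\<close>

lemma not_commuting_card:
  assumes A: "subgroup A G" and ab: "\<not> commuting A" shows "p\<^sup>2 \<le> card A"
proof -
  obtain x y where xy: "x \<in> A" "y \<in> A" "x \<otimes> y \<noteq> y \<otimes> x" using ab by (auto simp: commuting_def)
  have xc: "x \<in> carrier G" "y \<in> carrier G" using xy A subgroup_carrier by blast+
  have C: "subgroup (centralizer_in A x) G" by (rule centralizer_in_subgroup[OF A xc(1)])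
  have "x \<in> centralizer_in A x" "x \<noteq> \<one>" using xy xc centralizer_in_self by auto
  then have "{\<one>} \<subset> centralizer_in A x" using C subgroup.one_closed by blast
  then have "p \<le> card (centralizer_in A x)" using proper_card[OF triv_subgroup C] by simp
  moreover have "y \<in> A - centralizer_in A x" using xy by (auto simp: centralizer_in_def)
  then have "centralizer_in A x \<subset> A" using centralizer_in_sub by blast
  then have "p * card (centralizer_in A x) \<le> card A" using proper_card[OF C A] by simp
  ultimately show ?thesis by (metis le_trans mult_le_mono2 power2_eq_square)
qed

subsection \<open>The induction step for odd \<open>p\<close>\<close>

text \<open>The exception \<open>J = {\<one>}\<close> serves to drop \<open>J\<close>; it costs nothing because groups of order less than
  \<open>p\<^sup>2\<close> are abelian.\<close>

definition breadth_bound :: "'a set \<Rightarrow> bool" where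
  "breadth_bound A \<longleftrightarrow> (\<forall>\<H> J m. finite \<H> \<and> card \<H> \<le> p - 1 \<and> (\<forall>H\<in>\<H>. subgroup H G \<and> H \<subset> A)
     \<and> subgroup J G \<and> J \<subseteq> A \<and> (p\<^sup>2 * card J \<le> card A \<or> J = {\<one>})
     \<and> (\<forall>x\<in>A. x \<notin> \<Union>\<H> \<and> x \<notin> J \<longrightarrow> card A \<le> p ^ m * card (centralizer_in A x))
     \<longrightarrow> card (derived G A) \<le> p ^ (m * (m + 1) div 2))"

lemma breadth_boundD:
  assumes "breadth_bound A" "finite \<H>" "card \<H> \<le> p - 1" "\<And>H. H \<in> \<H> \<Longrightarrow> subgroup H G \<and> H \<subset> A"
    "subgroup J G" "J \<subseteq> A" "p\<^sup>2 * card J \<le> card A \<or> J = {\<one>}"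
    "\<And>x. x \<in> A \<Longrightarrow> x \<notin> \<Union>\<H> \<Longrightarrow> x \<notin> J \<Longrightarrow> card A \<le> p ^ m * card (centralizer_in A x)"
  shows "card (derived G A) \<le> p ^ (m * (m + 1) div 2)"
proof -
  have "\<forall>x\<in>A. x \<notin> \<Union>\<H> \<and> x \<notin> J \<longrightarrow> card A \<le> p ^ m * card (centralizer_in A x)"
    using assms(8) by (simp only: Ball_def) iprover
  moreover have "\<forall>H\<in>\<H>. subgroup H G \<and> H \<subset> A" using assms(4) by (rule ballI)
  ultimately show ?thesis
    using assms(1)[unfolded breadth_bound_def, THEN spec[of _ \<H>], THEN spec[of _ J], THEN spec[of _ m]]
      assms(2,3,5-7) by iprover
qed

text \<open>\<open>\<H>\<close> here has exactly \<open>p - 1 \<ge> 2\<close> members, all of index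
  \<open>p\<close>, which supplies \<open>P\<close> and \<open>Q\<close>; the slot freed by their
  common trace on \<open>S\<close> goes to T.\<close>

lemma breadth_bound_step_odd:
  assumes A: "subgroup A G" and IH: "\<And>S. subgroup S G \<Longrightarrow> card S < card A \<Longrightarrow> breadth_bound S"
    and ab: "\<not> commuting A" and p3: "p \<ge> 3"
    and fin: "finite \<H>" and cH: "card \<H> = p - 1" and H: "\<And>H. H \<in> \<H> \<Longrightarrow> index_p A H"
    and J: "subgroup J G" "J \<subseteq> A" "p\<^sup>2 * card J \<le> card A"
    and b: "\<And>x. x \<in> A \<Longrightarrow> x \<notin> \<Union>\<H> \<Longrightarrow> x \<notin> J \<Longrightarrow> card A \<le> p ^ m * card (centralizer_in A x)"
  shows "card (derived G A) \<le> p ^ (m * (m + 1) div 2)"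
proof -
  have "card \<H> \<ge> 2" using cH p3 by simp
  then have "\<not> (\<forall>P\<in>\<H>. \<forall>Q\<in>\<H>. P = Q)" using card_le_Suc0_iff_eq[OF fin] by simp
  then obtain P Q where PQ: "P \<in> \<H>" "Q \<in> \<H>" "P \<noteq> Q" by blast
  note P = H[OF PQ(1)] and Q = H[OF PQ(2)]
  define R where "R = P \<inter> Q"
  have R: "subgroup R G" unfolding R_def using index_pD(1)[OF P] index_pD(1)[OF Q] by (rule subgroup_inter)
  have triv: "p\<^sup>2 * card {\<one>} \<le> card A" using not_commuting_card[OF A ab] by simp
  \<comment> \<open>\<open>J\<close> must stay harmless inside \<open>S\<close>: either
    \<open>P\<close> covers it, or it shrinks on intersection with \<open>S\<close>, which preserves
    the index condition.\<close>
  have "\<exists>S. index_p A S \<and> R \<subseteq> S \<and> S \<notin> \<H> \<and> (J \<subseteq> R \<or> \<not> J \<subseteq> S)"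
  proof (cases "J \<subseteq> R")
    case True
    obtain a where "a \<in> A" "a \<notin> \<Union>\<H>"
      using index_p_no_cover[OF A fin _ H triv_subgroup triv] cH by auto
    moreover from this obtain S where "index_p A S" "R \<subseteq> S" "a \<in> S"
      using index_p_pencil[OF A P Q PQ(3)] unfolding R_def by blast
    ultimately show ?thesis using True by blast
  next
    case False
    then obtain j where j: "j \<in> J" "j \<notin> R" by blast
    \<comment> \<open>\<open>V\<close> is the pencil member through \<open>j\<close>. Choosing
      \<open>a\<close> outside \<open>V\<close> makes \<open>S\<close> a different member, which
      meets \<open>V\<close> only in \<open>R\<close>; so \<open>j\<close> is not in
      \<open>S\<close>.\<close>
    then obtain V where V: "index_p A V" "R \<subseteq> V" "j \<in> V"
      using index_p_pencil[OF A P Q PQ(3)] J(2) unfolding R_def by blast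
    have "card (insert V \<H>) \<le> p" using fin cH p3 by (simp add: card_insert_if)
    then obtain a where a: "a \<in> A" "a \<notin> \<Union>(insert V \<H>)"
      using index_p_no_cover[OF A _ _ _ triv_subgroup triv, of "insert V \<H>"] fin H V(1) by auto
    then obtain S where S: "index_p A S" "R \<subseteq> S" "a \<in> S"
      using index_p_pencil[OF A P Q PQ(3)] unfolding R_def by blast
    have "j \<notin> S"
    proof
      assume "j \<in> S"
      then have "R \<subset> S \<inter> V" using j V S by blast
      then have "p * card R \<le> card (S \<inter> V)"
        using proper_card[OF R] subgroup_inter index_pD(1)[OF S(1)] index_pD(1)[OF V(1)] by blast
      moreover have "card P = p * card R" unfolding R_def by (rule index_p_inter[OF A P Q PQ(3)])
      moreover have "card P = card S" using index_pD(3)[OF P] index_pD(3)[OF S(1)] p3 by simp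
      moreover have "S \<noteq> V" using S a by blast
      then have "card S = p * card (S \<inter> V)" by (rule index_p_inter[OF A S(1) V(1)])
      ultimately have "p * card (S \<inter> V) \<le> card (S \<inter> V)" by metis
      moreover have "card (S \<inter> V) > 0"
        using subgroup_card_pos subgroup_inter index_pD(1)[OF S(1)] index_pD(1)[OF V(1)] by blast
      ultimately show False using p3 by simp
    qed
    then show ?thesis using S a j by blast
  qed
  then obtain S where S: "index_p A S" "R \<subseteq> S" "S \<notin> \<H>" "J \<subseteq> R \<or> \<not> J \<subseteq> S" by blast
  note S' = index_pD[OF S(1)]
  \<comment> \<open>Hence the trace of \<open>Q\<close> on \<open>S\<close> may be left out of
    \<open>\<K>\<close>.\<close>
  have SQ: "S \<inter> Q \<subseteq> P"
    using index_p_pencil_inter[OF A Q P _ S(1)] S(2,3) PQ unfolding R_def by blast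
  define \<K> where "\<K> = (\<lambda>H. H \<inter> S) ` (\<H> - {Q})"
  have finK: "finite \<K>" using fin by (simp add: \<K>_def)
  have "card \<K> \<le> card (\<H> - {Q})" unfolding \<K>_def by (rule card_image_le) (use fin in simp)
  then have cK: "card \<K> \<le> p - 2" using cH PQ fin by simp
  have K: "subgroup K G \<and> K \<subset> S" if KK: "K \<in> \<K>" for K
  proof -
    obtain H' where H': "H' \<in> \<H>" "K = H' \<inter> S" using KK by (auto simp: \<K>_def)
    then have "\<not> S \<subseteq> H'" using index_p_subset_eq[OF S(1) H] S(3) by blast
    then show ?thesis using H' H[OF H'(1)] S' subgroup_inter index_pD by blast
  qed
  have UK: "x \<notin> \<Union>\<H>" if "x \<in> S" "x \<notin> \<Union>\<K>" for x
    using that SQ PQ unfolding \<K>_def by blast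
  define J' where "J' = (if J \<subseteq> R then {\<one>} else J \<inter> S)"
  have J': "subgroup J' G" "J' \<subseteq> S"
    using J S' subgroup_inter subgroup.one_closed by (auto simp: J'_def triv_subgroup)
  have J'c: "p\<^sup>2 * card J' \<le> card S \<or> J' = {\<one>}"
  proof (cases "J \<subseteq> R")
    case False
    then have "J \<inter> S \<subset> J" using S(4) by blast
    then have "p * card (J \<inter> S) \<le> card J" using proper_card subgroup_inter J S' by blast
    then have "p\<^sup>2 * (p * card (J \<inter> S)) \<le> p * card S" using J(3) S'(3) by (metis le_trans mult_le_mono2)
    then have "p\<^sup>2 * card (J \<inter> S) \<le> card S" using p3 by (simp add: power2_eq_square ac_simps)
    then show ?thesis using False by (simp add: J'_def)
  qed (simp add: J'_def)
  have UJ: "x \<notin> J" if "x \<in> S" "x \<notin> J'" "x \<notin> \<Union>\<K>" for x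
    using that UK[OF that(1,3)] PQ unfolding J'_def R_def by (auto split: if_splits)
  \<comment> \<open>An \<open>x\<close> of breadth at most \<open>m\<close> outside \<open>S\<close>
    is wanted, to bound |S : T|.\<close>
  have "card (insert S \<H>) \<le> p" using fin cH p3 by (simp add: card_insert_if)
  then obtain x where x: "x \<in> A" "x \<notin> S" "x \<notin> \<Union>\<H>" "x \<notin> J"
    using index_p_no_cover[OF A _ _ _ J(1,3), of "insert S \<H>"] fin H S(1) by auto
  have xc: "z \<in> carrier G" if "z \<in> A" for z using that A subgroup_carrier by blast
  have bS: "card S \<le> p ^ m * card (centralizer_in S z)" if "z \<in> A" "z \<notin> \<Union>\<H>" "z \<notin> J" for z
    using that by (intro breadth_mono[OF A S'(1,2)] b xc)
  note le = card_derived_le[OF A S(1) x(1,2) bS[OF x(1,3,4)]]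
  have bndS: "breadth_bound S" using IH S' index_p_proper[OF S(1)] psubset_card_mono[OF subgroup_finite[OF A]] by blast
  show ?thesis
  \<comment> \<open>If T is all of \<open>S\<close>, then A' and S' have equal order and
    \<open>m\<close> is kept. Otherwise T joins the family and \<open>m\<close> drops by
    one.\<close>
  proof (cases "centre_mod A S = S")
    case True
    then have "card (derived G A) = card (derived G S)"
      using card_derived_index_p[OF A S(1)] subgroup_card_pos[OF S'(1)] by simp
    moreover have "card (derived G S) \<le> p ^ (m * (m + 1) div 2)"
    proof (rule breadth_boundD[OF bndS finK _ K J' J'c])
      show "card \<K> \<le> p - 1" using cK by simp
      show "card S \<le> p ^ m * card (centralizer_in S z)" if "z \<in> S" "z \<notin> \<Union>\<K>" "z \<notin> J'" for z
        using that UK UJ S' by (intro bS) auto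
    qed
    ultimately show ?thesis by simp
  next
    case False
    then have T: "centre_mod A S \<subset> S" "subgroup (centre_mod A S) G" using centre_mod_sub centre_mod_subgroup[OF A S(1)] by blast+
    then have "card (centre_mod A S) < card S" using subgroup_finite S' psubset_card_mono by blast
    then have m: "m > 0" using le(1) by (cases m) auto
    have "card (derived G S) \<le> p ^ ((m - 1) * (m - 1 + 1) div 2)"
    proof (rule breadth_boundD[OF bndS _ _ _ J' J'c])
      show "finite (insert (centre_mod A S) \<K>)" using finK by simp
      have "card (insert (centre_mod A S) \<K>) \<le> Suc (card \<K>)" using finK by (simp add: card_insert_if)
      then show "card (insert (centre_mod A S) \<K>) \<le> p - 1" using cK p3 by linarith
      show "subgroup K G \<and> K \<subset> S" if "K \<in> insert (centre_mod A S) \<K>" for K using that T K by blast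
      show "card S \<le> p ^ (m - 1) * card (centralizer_in S z)"
        if "z \<in> S" "z \<notin> \<Union>(insert (centre_mod A S) \<K>)" "z \<notin> J'" for z
      proof -
        have "z \<in> A" "z \<notin> \<Union>\<H>" "z \<notin> J" "z \<notin> centre_mod A S" using that UK[of z] UJ[of z] S' by auto
        then show ?thesis using breadth_drop_outside_centre_mod[OF A S(1) that(1)] b by blast
      qed
    qed
    then have "card (derived G A) \<le> p ^ m * p ^ ((m - 1) * (m - 1 + 1) div 2)"
      using le(2) by (meson le_trans mult_le_mono2)
    then show ?thesis using triangle_pred[OF m] by (simp flip: power_add)
  qed
qed


lemma card_derived_le_centre_mod:
  assumes A: "subgroup A G" and S: "index_p A S" and c: "card S \<le> n * card (centre_mod A S)"
  shows "card (derived G A) \<le> n * card (derived G S)"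
proof -
  have "card (centre_mod A S) * card (derived G A) = card (derived G S) * card S"
    using card_derived_index_p[OF A S] by (simp add: mult.commute)
  also have "\<dots> \<le> card (derived G S) * (n * card (centre_mod A S))" using c by simp
  finally have "card (centre_mod A S) * card (derived G A) \<le> card (centre_mod A S) * (n * card (derived G S))"
    by (simp add: ac_simps)
  then show ?thesis using subgroup_card_pos[OF centre_mod_subgroup[OF A S]] by simp
qed

lemma centre_mod_conj:
  assumes A: "subgroup A G" and S: "index_p A S" and a: "a \<in> A" and t: "t \<in> centre_mod A S"
  shows "a \<otimes> t \<otimes> inv a \<in> centre_mod A S"
proof -
  have tS: "t \<in> S" using t centre_mod_sub by blast
  have c: "a \<in> carrier G" "t \<in> carrier G"
    using a A tS index_pD(1)[OF S] subgroup_carrier by blast+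
  have "comm b (a \<otimes> t \<otimes> inv a) \<in> derived G S" if b: "b \<in> A" for b
  proof -
    have bc: "b \<in> carrier G" using b A subgroup_carrier by blast
    have "inv a \<otimes> b \<otimes> a \<in> A" using a b A by (simp add: subgroup.m_closed subgroup.m_inv_closed)
    then have "comm (inv a \<otimes> b \<otimes> a) t \<in> derived G S" using t by (auto simp: centre_mod_def)
    then have "a \<otimes> comm (inv a \<otimes> b \<otimes> a) t \<otimes> inv a \<in> derived G S" by (rule index_p_derived_conj[OF A S a])
    moreover have "a \<otimes> comm (inv a \<otimes> b \<otimes> a) t \<otimes> inv a = comm b (a \<otimes> t \<otimes> inv a)"
      using c bc by (simp add: comm_def word)
    ultimately show ?thesis by simp
  qed
  then show ?thesis using index_p_conj[OF A S a tS] by (simp add: centre_mod_def)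
qed

lemma comm_central:
  assumes "z \<in> carrier G" "d \<in> carrier G" "y \<in> carrier G"
    and "z \<otimes> (d \<otimes> y \<otimes> inv d) = (d \<otimes> y \<otimes> inv d) \<otimes> z"
  shows "comm (z \<otimes> d) y = comm d y"
proof -
  have "comm (z \<otimes> d) y = (z \<otimes> (d \<otimes> y \<otimes> inv d)) \<otimes> inv z \<otimes> inv y"
    using assms(1-3) by (simp add: comm_def word)
  also have "\<dots> = comm d y" unfolding assms(4) using assms(1-3) by (simp add: comm_def word)
  finally show ?thesis .
qed

text \<open>The instance with one exceptional subgroup, where \<open>J\<close> is dropped by taking
  the value \<open>{\<one>}\<close>.\<close>

lemma breadth_bound_single:
  assumes "breadth_bound S" and S: "subgroup S G" "K \<subset> S" "subgroup K G"
    and b: "\<And>x. x \<in> S \<Longrightarrow> x \<notin> K \<Longrightarrow> card S \<le> p ^ m * card (centralizer_in S x)"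
  shows "card (derived G S) \<le> p ^ (m * (m + 1) div 2)"
proof (rule breadth_boundD[OF assms(1), of "{K}" "{\<one>}"])
  show "card {K} \<le> p - 1" using p_ge2 by simp
  show "{\<one>} \<subseteq> S" using S subgroup.one_closed by blast
qed (use assms triv_subgroup in auto)

end

subsection \<open>The induction step for \<open>p = 2\<close>\<close>

text \<open>The situation of a minimal counterexample: for \<open>p = 2\<close> the family has the
  single member \<open>H\<close>, \<open>big\<close> denies the bound for \<open>A\<close>, and
  \<open>IH\<close> grants it for smaller subgroups.\<close>

locale index2_step = finite_p_group +
  fixes A H J :: "'a set" and m :: nat
  assumes p2: "p = 2" and A: "subgroup A G" and H: "index_p A H" and J: "subgroup J G" "J \<subseteq> A" "4 * card J \<le> card A"
    and IH: "\<And>S. subgroup S G \<Longrightarrow> card S < card A \<Longrightarrow> breadth_bound S"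
    and breadth: "\<And>x. x \<in> A \<Longrightarrow> x \<notin> H \<Longrightarrow> x \<notin> J \<Longrightarrow> card A \<le> p ^ m * card (centralizer_in A x)"
    and big: "\<not> card (derived G A) \<le> p ^ (m * (m + 1) div 2)"
begin

lemma Ac: "x \<in> A \<Longrightarrow> x \<in> carrier G"
  using A subgroup_carrier by blast

text \<open>Index 2 makes membership in \<open>P\<close> a parity. If both factors lie outside
  \<open>P\<close>, translation by the inverse of the first maps \<open>P\<close> onto its
  complement and so reaches the second.\<close>

lemma index_p_mult_iff:
  assumes B: "subgroup B G" and P: "index_p B P" and a: "a \<in> B" and b: "b \<in> B"
  shows "a \<otimes> b \<in> P \<longleftrightarrow> (a \<in> P \<longleftrightarrow> b \<in> P)"
proof -
  note P' = index_pD[OF P] and c = subgroup_carrier[OF B]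
  have 1: "b \<in> P" if "a \<in> P" "a \<otimes> b \<in> P"
  proof -
    have "inv a \<otimes> (a \<otimes> b) \<in> P" by (rule subgroup.m_closed[OF P'(1) subgroup.m_inv_closed[OF P'(1) that(1)] that(2)])
    then show ?thesis using a b c by simp
  qed
  have 2: "a \<in> P" if "b \<in> P" "a \<otimes> b \<in> P"
  proof -
    have "(a \<otimes> b) \<otimes> inv b \<in> P" by (rule subgroup.m_closed[OF P'(1) that(2) subgroup.m_inv_closed[OF P'(1) that(1)]])
    then show ?thesis using a b c by (simp add: m_assoc)
  qed
  have 3: "a \<otimes> b \<in> P" if "a \<notin> P" "b \<notin> P"
  proof -
    let ?f = "\<lambda>x. inv a \<otimes> x"
    have "?f ` P \<subseteq> B - P"
    proof
      fix y assume "y \<in> ?f ` P"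
      then obtain x where x: "x \<in> P" "y = inv a \<otimes> x" by blast
      have xB: "x \<in> B" using x P' by blast
      have "y \<in> B" using x(2) xB a B by (simp add: subgroup.m_closed subgroup.m_inv_closed)
      moreover have "y \<notin> P"
      proof
        assume "y \<in> P"
        then have "x \<otimes> inv y \<in> P" using x P' by (simp add: subgroup.m_closed subgroup.m_inv_closed)
        moreover have "x \<otimes> inv y = a" unfolding x(2) using xB a c by (simp add: word)
        ultimately show False using that by simp
      qed
      ultimately show "y \<in> B - P" by blast
    qed
    moreover have "card (?f ` P) = card P"
      using a P' c by (intro card_image) (auto simp: inj_on_def subset_iff)
    moreover have "card (B - P) = card P"
      using P' p2 by (simp add: card_Diff_subset subgroup_finite)
    ultimately have "?f ` P = B - P" using B by (intro card_subset_eq) (auto simp: subgroup_finite)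
    then have "b \<in> ?f ` P" using b that by simp
    then obtain x where x: "x \<in> P" "b = inv a \<otimes> x" by blast
    have "x \<in> B" using x P' by blast
    then show ?thesis using x a c by simp
  qed
  show ?thesis using 1 2 3 P' by (auto simp: subgroup.m_closed)
qed

text \<open>Converse to \<open>index_p_mult_iff\<close>: multiplication by \<open>x\<close> swaps
  the two halves.\<close>

lemma index_p_parity:
  assumes B: "subgroup B G" and mult: "\<And>a b. a \<in> B \<Longrightarrow> b \<in> B \<Longrightarrow> \<phi> (a \<otimes> b) \<longleftrightarrow> (\<phi> a \<longleftrightarrow> \<phi> b)"
    and x: "x \<in> B" "\<not> \<phi> x"
  shows "index_p B {a \<in> B. \<phi> a}"
proof -
  let ?U = "{a \<in> B. \<phi> a}"
  note c = subgroup_carrier[OF B]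
  have one: "\<phi> \<one>" using mult[of \<one> \<one>] B by (simp add: subgroup.one_closed)
  have inv: "\<phi> (inv a) \<longleftrightarrow> \<phi> a" if "a \<in> B" for a
    using mult[of "inv a" a] one that B c by (simp add: subgroup.m_inv_closed)
  have U: "subgroup ?U G"
  proof (rule subgroupI)
    show "?U \<subseteq> carrier G" using c by blast
    show "?U \<noteq> {}" using one B subgroup.one_closed by blast
  qed (use mult inv B in \<open>auto simp: subgroup.m_closed subgroup.m_inv_closed\<close>)
  have inj: "inj_on ((\<otimes>) x) B" using x c by (auto simp: inj_on_def)
  have fin: "finite B" using B by (rule subgroup_finite)
  have "card ?U \<le> card (B - ?U)"
  proof (rule card_inj_on_le)
    show "inj_on ((\<otimes>) x) ?U" using inj by (rule inj_on_subset) blast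
    show "(\<otimes>) x ` ?U \<subseteq> B - ?U" using x mult B by (auto simp: subgroup.m_closed)
  qed (use fin in simp)
  moreover have "card (B - ?U) \<le> card ?U"
  proof (rule card_inj_on_le)
    show "inj_on ((\<otimes>) x) (B - ?U)" using inj by (rule inj_on_subset) blast
    show "(\<otimes>) x ` (B - ?U) \<subseteq> ?U" using x mult B by (auto simp: subgroup.m_closed)
  qed (use fin in simp)
  moreover have "card B = card ?U + card (B - ?U)"
    using fin card_Un_disjoint[of ?U "B - ?U"] by (simp add: Un_absorb1 subset_iff)
  ultimately have "card B = p * card ?U" using p2 by simp
  then show ?thesis using U unfolding index_p_def by blast
qed

text \<open>For distinct \<open>P\<close>, \<open>Q\<close> of index 2 this is the remaining
  subgroup of index 2 containing \<open>P \<inter> Q\<close>.\<close>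

definition third :: "'a set \<Rightarrow> 'a set \<Rightarrow> 'a set \<Rightarrow> 'a set" where
  "third B P Q = {a \<in> B. a \<in> P \<longleftrightarrow> a \<in> Q}"

lemma index_p_third:
  assumes B: "subgroup B G" and P: "index_p B P" and Q: "index_p B Q" and "P \<noteq> Q"
  shows "index_p B (third B P Q)"
proof -
  have "\<not> P \<subseteq> Q" using index_p_subset_eq[OF P Q] assms(4) by blast
  then obtain x where "x \<in> P" "x \<notin> Q" by blast
  moreover from this have "x \<in> B" using index_pD(2)[OF P] by blast
  ultimately show ?thesis
    unfolding third_def using index_p_mult_iff[OF B P] index_p_mult_iff[OF B Q] by (intro index_p_parity[OF B]) auto
qed

text \<open>The condition on \<open>J\<close> ensures that every element of \<open>S\<close> outside
  \<open>H\<close> obeys the breadth bound, so only \<open>H \<inter> S\<close> is exceptional in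
  \<open>S\<close>.\<close>

definition good :: "'a set \<Rightarrow> bool" where
  "good S \<longleftrightarrow> index_p A S \<and> S \<noteq> H \<and> S \<inter> J \<subseteq> H"

definition central :: "'a set \<Rightarrow> 'a \<Rightarrow> bool" where
  "central S u \<longleftrightarrow> u \<in> S \<and> (\<forall>s\<in>S. u \<otimes> s = s \<otimes> u)"

text \<open>A small enough bound on S' contradicts \<open>big\<close>, and the induction hypothesis
  for \<open>S\<close>, T and a third subgroup \<open>W\<close> of index 2 in \<open>S\<close> would
  give one unless this structure holds. The central element is found among the elements of
  \<open>W\<close> that are central in \<open>S\<close> modulo W'.\<close>

lemma good_structure:
  assumes S: "good S"
  shows "card S = 2 * card (centre_mod A S)" "card (derived G A) = 2 * card (derived G S)"
    "\<not> centre_mod A S \<subseteq> H" "\<exists>u. central S u \<and> u \<notin> H \<and> u \<notin> centre_mod A S"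
proof -
  have mS: "index_p A S" and SH: "S \<noteq> H" and SJ: "S \<inter> J \<subseteq> H" using S by (auto simp: good_def)
  note S' = index_pD[OF mS] and H' = index_pD[OF H]
  have Sc: "x \<in> carrier G" if "x \<in> S" for x using that S' Ac by blast
  have cSA: "card S < card A" using index_p_proper[OF mS] psubset_card_mono[OF subgroup_finite[OF A]] by blast
  have bndS: "breadth_bound S" using IH[OF S'(1) cSA] .
  define K where "K = H \<inter> S"
  have mK: "index_p S K"
  proof -
    have "card S = p * card (S \<inter> H)" by (rule index_p_inter[OF A mS H SH])
    then show ?thesis unfolding K_def index_p_def using subgroup_inter[OF H'(1) S'(1)] by (simp add: Int_commute)
  qed
  note K' = index_pD[OF mK]
  have "card {S, H} \<le> p" using p2 by (simp add: card_insert_if)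
  then obtain x0 where x0: "x0 \<in> A" "x0 \<notin> S" "x0 \<notin> H" "x0 \<notin> J"
    using index_p_no_cover[OF A _ _ _ J(1), of "{S, H}"] mS H J(3) p2 by auto
  have bS: "card S \<le> p ^ m * card (centralizer_in S z)" if "z \<in> A" "z \<notin> H" "z \<notin> J" for z
    using that by (intro breadth_mono[OF A S'(1,2)] breadth Ac)
  have notJ: "z \<in> A \<and> z \<notin> J" if "z \<in> S" "z \<notin> H" for z using that SJ S' by blast
  note le = card_derived_le[OF A mS x0(1,2) bS[OF x0(1,3,4)]]
  let ?T = "centre_mod A S" and ?N = "p ^ (m * (m + 1) div 2)" and ?N' = "p ^ ((m - 1) * (m - 1 + 1) div 2)"
  have T: "subgroup ?T G" by (rule centre_mod_subgroup[OF A mS])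
  have "?T \<noteq> S"
  proof
    assume "?T = S"
    then have "card (derived G A) = card (derived G S)"
      using card_derived_index_p[OF A mS] subgroup_card_pos[OF S'(1)] by simp
    moreover have "card (derived G S) \<le> ?N"
      using notJ bS by (intro breadth_bound_single[OF bndS S'(1) index_p_proper[OF mK] K'(1)]) (auto simp: K_def)
    ultimately show False using big by simp
  qed
  then have TS: "?T \<subset> S" using centre_mod_sub by blast
  then have "card ?T < card S" using subgroup_finite S' psubset_card_mono by blast
  then have m: "m > 0" using le(1) by (cases m) auto
  \<comment> \<open>\<open>fin\<close>, and later \<open>fin2\<close>, are the ways to contradict
    \<open>big\<close>; \<open>?N'\<close> is the bound for breadth \<open>m - 1\<close>.\<close>
  have fin: False if "card (derived G S) \<le> ?N'"
  proof -
    have "card (derived G A) \<le> p ^ m * ?N'" using le(2) that by (meson le_trans mult_le_mono2)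
    then show False using big triangle_pred[OF m] by (simp flip: power_add)
  qed
  have drop: "card S \<le> p ^ (m - 1) * card (centralizer_in S z)" if "z \<in> S" "z \<notin> H" "z \<notin> ?T" for z
    using breadth_drop_outside_centre_mod[OF A mS that(1,3)] breadth notJ[OF that(1,2)] that by blast
  \<comment> \<open>A T of index at least 4 in \<open>S\<close> could play the role of
    \<open>J\<close> in the induction hypothesis for \<open>S\<close>.\<close>
  have "\<not> p\<^sup>2 * card ?T \<le> card S"
  proof
    assume c: "p\<^sup>2 * card ?T \<le> card S"
    have "card (derived G S) \<le> ?N'"
    proof (rule breadth_boundD[OF bndS, of "{K}" ?T])
      show "subgroup K' G \<and> K' \<subset> S" if "K' \<in> {K}" for K' using that K' index_p_proper[OF mK] by blast
    qed (use p2 T TS c drop in \<open>auto simp: K_def\<close>)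
    then show False by (rule fin)
  qed
  then have "p * card S \<le> p\<^sup>2 * card ?T" by (intro subgroup_card_less[OF S'(1) T]) auto
  then have "card S \<le> p * card ?T" using p2 by (simp add: power2_eq_square)
  moreover have "p * card ?T \<le> card S" by (rule proper_card[OF T S'(1) TS])
  ultimately have cT: "card S = p * card ?T" by simp
  then show "card S = 2 * card ?T" using p2 by simp
  have mT: "index_p S ?T" unfolding index_p_def using T TS cT by blast
  have "card (derived G A) * card ?T = (p * card (derived G S)) * card ?T"
    using card_derived_index_p[OF A mS] cT by (simp add: ac_simps)
  then have dAS: "card (derived G A) = p * card (derived G S)" using subgroup_card_pos[OF T] by simp
  then show "card (derived G A) = 2 * card (derived G S)" using p2 by simp
  \<comment> \<open>Since |A' : S'| is now exactly \<open>p\<close>, a bound on S' weaker by the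
    factor \<open>p ^ (m - 1)\<close> is still contradictory.\<close>
  have fin2: False if "card (derived G S) \<le> p ^ (m - 1) * ?N'"
  proof -
    have "card (derived G A) \<le> p * (p ^ (m - 1) * ?N')" using that dAS by simp
    also have "\<dots> = p ^ m * ?N'" using m by (cases m) (simp_all add: ac_simps)
    finally show False using big triangle_pred[OF m] by (simp flip: power_add)
  qed
  show TH: "\<not> ?T \<subseteq> H"
  proof
    assume TH: "?T \<subseteq> H"
    have "card (derived G S) \<le> ?N'"
      using TH drop by (intro breadth_bound_single[OF bndS S'(1) index_p_proper[OF mK] K'(1)]) (auto simp: K_def)
    then show False by (rule fin)
  qed
  have TK: "?T \<noteq> K" using TH by (auto simp: K_def)
  \<comment> \<open>An element of \<open>W\<close> outside \<open>H\<close> is also outside T, so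
    its breadth drops; this bounds W' by \<open>?N'\<close>.\<close>
  define W where "W = third S ?T K"
  have mW: "index_p S W" unfolding W_def by (rule index_p_third[OF S'(1) mT mK TK])
  note W' = index_pD[OF mW]
  have Wiff: "s \<in> W \<longleftrightarrow> (s \<in> ?T \<longleftrightarrow> s \<in> H)" if "s \<in> S" for s
    using that by (auto simp: W_def third_def K_def)
  have "\<exists>w\<in>W. w \<notin> H"
  proof (rule ccontr)
    assume "\<not> ?thesis"
    then have "W \<subseteq> ?T" using Wiff W' by blast
    then have "W = ?T" by (rule index_p_subset_eq[OF mW mT])
    then have "?T \<subseteq> H" using Wiff TS by blast
    then show False using TH by simp
  qed
  then obtain w where w: "w \<in> W" "w \<notin> H" by blast
  have wT: "w \<in> S" "w \<notin> ?T" using w Wiff W' by blast+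
  obtain t0 where t0: "t0 \<in> ?T" "t0 \<notin> H" using TH by blast
  have less: "card U < card A" if "U \<subseteq> S" for U
    using that card_mono[OF subgroup_finite[OF S'(1)]] cSA by (meson le_less_trans)
  have "card (derived G W) \<le> ?N'"
  proof (rule breadth_bound_single[OF IH[OF W'(1) less[OF W'(2)]] W'(1), of "W \<inter> H"])
    show "W \<inter> H \<subset> W" using w by blast
    show "subgroup (W \<inter> H) G" using W' H' subgroup_inter by blast
    fix x assume x: "x \<in> W" "x \<notin> W \<inter> H"
    then have "x \<in> S" "x \<notin> H" "x \<notin> ?T" using Wiff W' by blast+
    then show "card W \<le> p ^ (m - 1) * card (centralizer_in W x)"
      by (intro breadth_mono[OF S'(1) W'(1,2) Sc] drop)
  qed
  then have notW: "\<not> card W \<le> p ^ (m - 1) * card (centre_mod S W)"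
    using card_derived_le_centre_mod[OF S'(1) mW] fin2 by (meson le_trans mult_le_mono2)
  define V where "V = centre_mod S W"
  have V: "subgroup V G" unfolding V_def by (rule centre_mod_subgroup[OF S'(1) mW])
  have VW: "V \<subseteq> W" unfolding V_def by (rule centre_mod_sub)
  have cV: "p ^ m * card V \<le> card W"
  proof -
    obtain i j where ij: "card V = p ^ i" "card W = p ^ j" using subgroup_card V W'(1) by blast
    have "p ^ (m - 1 + i) < p ^ j" using notW ij by (simp add: V_def power_add)
    then have "m - 1 + i < j" using p_ge2 power_less_imp_less_exp by (metis Suc_1 Suc_le_lessD)
    then have "p ^ (m + i) \<le> p ^ j" using m p_ge2 by (intro power_increasing) auto
    then show ?thesis using ij by (simp only: power_add)
  qed
  \<comment> \<open>\<open>t\<close> lies outside \<open>W\<close>, so its centralizer in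
    \<open>W\<close> is contained in \<open>V\<close>; the index is at most \<open>p ^ m\<close> for
    the former and at least \<open>p ^ m\<close> for \<open>V\<close>.\<close>
  have centralizer_V: "centralizer_in W t = V" if "t \<in> ?T" "t \<notin> H" for t
  proof -
    have t: "t \<in> S" "t \<notin> W" using that Wiff TS by blast+
    have sub: "centralizer_in W t \<subseteq> V" unfolding V_def by (rule centralizer_in_sub_centre_mod[OF S'(1) mW t])
    have "card W \<le> p ^ m * card (centralizer_in W t)"
      using notJ[OF t(1) that(2)] bS that(2) by (intro breadth_mono[OF S'(1) W'(1,2) Sc[OF t(1)]]) blast
    with cV have "p ^ m * card V \<le> p ^ m * card (centralizer_in W t)" by (rule le_trans)
    then have "card V \<le> card (centralizer_in W t)" using p_ge2 by simp
    then show ?thesis using sub card_seteq[OF subgroup_finite[OF V]] by blast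
  qed
  have VT: "?T \<subseteq> centralizer_in S v" if v: "v \<in> V" for v
  proof
    have vc: "v \<in> carrier G" using v VW W' Sc by blast
    have C: "subgroup (centralizer_in S v) G" by (rule centralizer_in_subgroup[OF S'(1) vc])
    have in1: "t \<in> centralizer_in S v" if "t \<in> ?T" "t \<notin> H" for t
      using centralizer_V[OF that] v that TS by (auto simp: centralizer_in_def)
    fix t assume t: "t \<in> ?T"
    show "t \<in> centralizer_in S v"
    \<comment> \<open>T is generated by its elements outside \<open>H\<close>: multiplication by
      \<open>t0\<close> leaves \<open>H\<close>.\<close>
    proof (cases "t \<in> H")
      case True
      have tA: "t \<in> A" "t0 \<in> A" using t t0 TS S' by blast+
      have "t0 \<otimes> t \<in> ?T" by (rule subgroup.m_closed[OF T t0(1) t])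
      moreover have "t0 \<otimes> t \<notin> H" using index_p_mult_iff[OF A H tA(2,1)] True t0 by blast
      ultimately have "t0 \<otimes> t \<in> centralizer_in S v" by (rule in1)
      then have "inv t0 \<otimes> (t0 \<otimes> t) \<in> centralizer_in S v"
        by (rule subgroup.m_closed[OF C subgroup.m_inv_closed[OF C in1[OF t0]]])
      then show ?thesis using tA Ac by simp
    qed (use in1 t in blast)
  qed
  \<comment> \<open>Otherwise any element of T outside \<open>H\<close> centralizes \<open>V\<close>
    and itself, hence a subgroup of T larger than \<open>V\<close>, and its breadth in T is at most
    \<open>m - 1\<close>. Passing from T to \<open>S\<close> by means of \<open>w\<close> then
    contradicts \<open>fin2\<close>.\<close>
  have "\<not> V \<subseteq> ?T"
  proof
    assume VsT: "V \<subseteq> ?T"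
    have "card (derived G ?T) \<le> ?N'"
    proof (rule breadth_bound_single[OF IH[OF T less] T, of "?T \<inter> H"])
      show "?T \<subseteq> S" by (rule centre_mod_sub)
      show "?T \<inter> H \<subset> ?T" using TH by blast
      show "subgroup (?T \<inter> H) G" using T H' subgroup_inter by blast
      fix t assume "t \<in> ?T" "t \<notin> ?T \<inter> H"
      then have t: "t \<in> ?T" "t \<notin> H" by blast+
      have tc: "t \<in> carrier G" using t TS Sc by blast
      have "t \<notin> V" using t Wiff TS VW by blast
      moreover have "V \<subseteq> centralizer_in ?T t" using VsT centralizer_V[OF t] by (auto simp: centralizer_in_def)
      ultimately have "V \<subset> centralizer_in ?T t" using centralizer_in_self t by blast
      then have "p * card V \<le> card (centralizer_in ?T t)" by (rule proper_card[OF V centralizer_in_subgroup[OF T tc]])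
      then have "p ^ (m - 1) * (p * card V) \<le> p ^ (m - 1) * card (centralizer_in ?T t)" by simp
      moreover have "p ^ (m - 1) * (p * card V) = p ^ m * card V" using m by (cases m) (simp_all add: ac_simps)
      moreover have "card ?T = card W" using index_pD(3)[OF mT] W'(3) p2 by simp
      moreover have "card W \<le> p ^ m * card (centralizer_in W t)"
        using t TS notJ[of t] bS[of t] by (intro breadth_mono[OF S'(1) W'(1,2) tc]) blast
      ultimately show "card ?T \<le> p ^ (m - 1) * card (centralizer_in ?T t)" unfolding centralizer_V[OF t] by linarith
    qed
    moreover have "card (derived G S) \<le> p ^ (m - 1) * card (derived G ?T)"
      by (rule card_derived_le(2)[OF S'(1) mT wT])
        (intro breadth_mono[OF S'(1) T centre_mod_sub Sc[OF wT(1)]] drop wT w)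
    ultimately have "card (derived G S) \<le> p ^ (m - 1) * ?N'" by (meson le_trans mult_le_mono2)
    then show False by (rule fin2)
  qed
  then obtain u where u: "u \<in> V" "u \<notin> ?T" by blast
  have uS: "u \<in> S" "u \<notin> H" using u VW W' Wiff by blast+
  \<comment> \<open>\<open>u\<close> centralizes T and itself, and T is maximal in
    \<open>S\<close>.\<close>
  have "S \<subseteq> centralizer_in S u"
    by (rule index_p_maximal[OF S'(1) mT centralizer_in_subgroup[OF S'(1) Sc[OF uS(1)]] VT[OF u(1)] centralizer_in_self[OF uS(1)] uS(1) u(2)])
  then have "central S u" using uS by (auto simp: central_def centralizer_in_def)
  then show "\<exists>u. central S u \<and> u \<notin> H \<and> u \<notin> ?T" using u uS by blast
qed


lemma goodD:
  "good S \<Longrightarrow> index_p A S"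
  "good S \<Longrightarrow> S \<noteq> H"
  "good S \<Longrightarrow> x \<in> S \<Longrightarrow> x \<in> J \<Longrightarrow> x \<in> H"
  by (auto simp: good_def)

lemma not_commuting: "\<not> commuting A"
proof
  assume "commuting A"
  then have "card (derived G A) = 1" by (rule commuting_derived[OF A])
  then show False using big p_ge2 by simp
qed

text \<open>An element of \<open>third A M H\<close> that lies in \<open>M\<close> lies in
  \<open>H\<close>, so \<open>J\<close> inside either of them meets it within
  \<open>H\<close>.\<close>

lemma good_third:
  assumes M: "index_p A M" "M \<noteq> H" and JM: "J \<subseteq> M \<or> J \<subseteq> H"
  shows "good (third A M H)"
proof -
  have "third A M H \<noteq> H"
  proof
    assume "third A M H = H"
    then have "H \<subseteq> M" by (auto simp: third_def)
    then show False using index_p_subset_eq[OF H M(1)] M(2) by simp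
  qed
  then show ?thesis
    unfolding good_def using index_p_third[OF A M(1) H M(2)] JM by (auto simp: third_def)
qed

text \<open>Such an \<open>M\<close> yields a good \<open>S1\<close> that does not contain
  \<open>u\<close>. Then T is \<open>S \<inter> S1\<close> for both \<open>S\<close> and
  \<open>S1\<close>, and a further good subgroup \<open>S2\<close> has no room for its own central
  element outside \<open>H\<close>.\<close>

lemma no_index_p_through:
  assumes S: "good S" and u: "central S u" "u \<notin> H" "u \<notin> centre_mod A S"
    and M: "index_p A M" "u \<in> M" and JM: "J \<subseteq> M \<or> J \<subseteq> H"
  shows False
proof -
  define S1 where "S1 = third A M H"
  have "M \<noteq> H" using M u by blast
  then have S1: "good S1" unfolding S1_def by (rule good_third[OF M(1) _ JM])
  note mS = goodD(1)[OF S] and mS1 = goodD(1)[OF S1]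
  note S' = index_pD[OF mS] and S1' = index_pD[OF mS1]
  note str = good_structure[OF S] and str1 = good_structure[OF S1]
  obtain u1 where u1: "central S1 u1" "u1 \<notin> H" "u1 \<notin> centre_mod A S1" using str1(4) by blast
  have uS: "u \<in> S" "u \<notin> S1" using u M by (auto simp: central_def S1_def third_def)
  have uA: "u \<in> A" using uS S' by blast
  have ne: "S \<noteq> S1" using uS by blast
  define R where "R = S \<inter> S1"
  have R: "subgroup R G" unfolding R_def by (rule subgroup_inter[OF S'(1) S1'(1)])
  have mR: "index_p S R"
    unfolding index_p_def using index_p_inter[OF A mS mS1 ne] R by (simp add: R_def)
  have mR1: "index_p S1 R"
    unfolding index_p_def using index_p_inter[OF A mS1 mS] ne R by (simp add: R_def Int_commute)
  have comu: "comm u r = \<one>" if "r \<in> S" for r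
  proof -
    have "u \<otimes> r = r \<otimes> u" using u(1) that by (auto simp: central_def)
    moreover have "r \<in> A" using that S'(2) by blast
    ultimately show ?thesis using comm_eq_one[of u r] Ac uA by blast
  qed
  have one_in: "\<one> \<in> derived G B" if "subgroup B G" for B
    using derived_subgroup[OF that] by (rule subgroup.one_closed)
  \<comment> \<open>\<open>u\<close> centralizes \<open>R\<close> and lies in \<open>S\<close>
    outside it; so R' and S' will have the same order by
    \<open>card_derived_index_p\<close>.\<close>
  have "R \<subseteq> centre_mod S R"
  proof
    fix r assume r: "r \<in> R"
    have "comm u r = \<one>" using comu r by (simp add: R_def)
    then have "comm u r \<in> derived G R" using one_in[OF R] by simp
    moreover have "u \<notin> R" using uS by (simp add: R_def)
    ultimately show "r \<in> centre_mod S R" using centre_mod_iff[OF S'(1) mR uS(1) _ r] by blast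
  qed
  then have "centre_mod S R = R" using centre_mod_sub by blast
  then have "card (derived G S) = card (derived G R)"
    using card_derived_index_p[OF S'(1) mR] subgroup_card_pos[OF R] by simp
  then have dR: "derived G R = derived G S"
    using card_subset_eq[OF subgroup_finite[OF derived_subgroup[OF S'(1)]] mono_derived] index_pD(2)[OF mR] by simp
  \<comment> \<open>Both orders are half that of A', so the derived subgroups of \<open>R\<close>,
    \<open>S\<close> and \<open>S1\<close> coincide.\<close>
  have "card (derived G S1) = card (derived G S)" using str(2) str1(2) by simp
  then have dS1: "derived G S1 = derived G S"
    using dR card_subset_eq[OF subgroup_finite[OF derived_subgroup[OF S1'(1)]] mono_derived[OF index_pD(2)[OF mR1]]] by simp
  have cR: "card S = 2 * card R" "card S1 = 2 * card R" using index_pD(3)[OF mR] index_pD(3)[OF mR1] p2 by simp_all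
  obtain x where x: "x \<in> S1" "x \<notin> S" using index_p_proper[OF mR1] R_def by blast
  have "R \<subseteq> centre_mod A S"
  proof
    fix r assume r: "r \<in> R"
    then have "comm x r \<in> derived G S1" using x by (intro comm_derived) (auto simp: R_def)
    then show "r \<in> centre_mod A S" using centre_mod_iff[OF A mS _ x(2)] x S1' r dS1 by (auto simp: R_def)
  qed
  then have T: "centre_mod A S = R"
    using card_subset_eq[OF subgroup_finite[OF centre_mod_subgroup[OF A mS]], of R] cR str(1) by simp
  have "R \<subseteq> centre_mod A S1"
  proof
    fix r assume r: "r \<in> R"
    then have "comm u r \<in> derived G S1" using comu[of r] one_in[OF S1'(1)] by (simp add: R_def)
    then show "r \<in> centre_mod A S1" using centre_mod_iff[OF A mS1 uA uS(2)] r by (simp add: R_def)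
  qed
  then have T1: "centre_mod A S1 = R"
    using card_subset_eq[OF subgroup_finite[OF centre_mod_subgroup[OF A mS1]], of R] cR str1(1) by simp
  have u1S: "u1 \<in> S1" "u1 \<notin> S" using u1 T1 by (auto simp: central_def R_def)
  have u1A: "u1 \<in> A" using u1S S1' by blast
  txt \<open>A central element of \<open>S2\<close> lies in \<open>S\<close> or in \<open>S1\<close> and commutes with \<open>u\<close> and \<open>u1\<close>,
    hence belongs to \<open>R\<close>.\<close>
  define S2 where "S2 = {a \<in> A. ((a \<in> S) = (a \<in> S1)) = (a \<in> H)}"
  \<comment> \<open>\<open>S2\<close> is the kernel of the product of three parities;
    \<open>y\<close> shows that this product is not constant.\<close>
  obtain y where y: "y \<in> R" "y \<notin> H" using str(3) T by blast
  have "index_p A S2"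
    unfolding S2_def
  proof (rule index_p_parity[OF A])
    show "y \<in> A" using y S' by (auto simp: R_def)
    show "\<not> ((y \<in> S) = (y \<in> S1)) = (y \<in> H)" using y by (simp add: R_def)
  qed (use index_p_mult_iff[OF A mS] index_p_mult_iff[OF A mS1] index_p_mult_iff[OF A H] in auto)
  moreover have "u \<in> S2" "u1 \<in> S2"
    unfolding S2_def using uS u1S uA u1A u(2) u1(2) by simp_all
  \<comment> \<open>An element of \<open>J\<close> outside \<open>H\<close> lies in neither
    \<open>S\<close> nor \<open>S1\<close>, which the parity condition of \<open>S2\<close>
    excludes.\<close>
  moreover have "j \<in> H" if "j \<in> S2" "j \<in> J" for j
    using that goodD(3)[OF S, of j] goodD(3)[OF S1, of j] by (auto simp: S2_def)
  ultimately have "good S2" using u unfolding good_def by blast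
  then obtain u2 where u2: "central S2 u2" "u2 \<notin> H" using good_structure(4) by blast
  have com2: "comm z u2 = \<one>" if "z \<in> S2" for z
  proof -
    have "z \<otimes> u2 = u2 \<otimes> z" using u2(1) that by (auto simp: central_def)
    moreover have "z \<in> A" "u2 \<in> A" using that u2 by (auto simp: central_def S2_def)
    ultimately show ?thesis using comm_eq_one[of z u2] Ac by blast
  qed
  have "(u2 \<in> S) \<noteq> (u2 \<in> S1)" using u2 by (auto simp: central_def S2_def)
  moreover have "u2 \<in> centre_mod A S" if "u2 \<in> S"
    using centre_mod_iff[OF A mS u1A u1S(2) that] com2[OF \<open>u1 \<in> S2\<close>] one_in[OF S'(1)] by simp
  moreover have "u2 \<in> centre_mod A S1" if "u2 \<in> S1"
    using centre_mod_iff[OF A mS1 uA uS(2) that] com2[OF \<open>u \<in> S2\<close>] one_in[OF S1'(1)] by simp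
  ultimately show False using T T1 by (auto simp: R_def)
qed

text \<open>A proper \<open>U\<close> would lie in a subgroup of index 2 through \<open>u\<close>
  containing \<open>J\<close>. In this form the nonexistence yields product decompositions of
  \<open>A\<close>.\<close>

lemma subgroup_through:
  assumes S: "good S" and u: "central S u" "u \<notin> H" "u \<notin> centre_mod A S"
    and U: "subgroup U G" "U \<subseteq> A" "u \<in> U" "J \<subseteq> U"
  shows "U = A"
proof (rule ccontr)
  assume "U \<noteq> A"
  then obtain M where "index_p A M" "U \<subseteq> M" using index_p_exists[OF U(1) A] U(2) by blast
  then show False using no_index_p_through[OF S u] U by blast
qed

text \<open>With \<open>D = J \<inter> H\<close>, generation by \<open>u\<close> and
  \<open>J\<close> gives S = Z D for the centre \<open>Z\<close> of \<open>S\<close>, so S' = D'.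
  Some \<open>E\<close> containing \<open>D\<close> with index 2 obeys the induction hypothesis, yet
  E' is at least as large as A'.\<close>

lemma contradiction: False
proof -
  note H' = index_pD[OF H]
  have "\<exists>M. index_p A M \<and> M \<noteq> H \<and> (J \<subseteq> M \<or> J \<subseteq> H)"
  proof (cases "J \<subseteq> H")
    case True
    obtain x where "x \<in> A" "x \<notin> H" using index_p_proper[OF H] by blast
    then show ?thesis using not_commuting_index_p[OF A not_commuting] True by blast
  next
    case False
    have "card J < card A" using J(3) subgroup_card_pos[OF J(1)] by linarith
    then have "J \<subset> A" using J(2) by blast
    then show ?thesis using index_p_exists[OF J(1) A] False by blast
  qed
  then obtain M where M: "index_p A M" "M \<noteq> H" "J \<subseteq> M \<or> J \<subseteq> H" by blast
  define S where "S = third A M H"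
  have S: "good S" unfolding S_def by (rule good_third[OF M])
  note mS = goodD(1)[OF S]
  note S' = index_pD[OF mS] and str = good_structure[OF S]
  let ?T = "centre_mod A S"
  obtain u where u: "central S u" "u \<notin> H" "u \<notin> ?T" using str(4) by blast
  note through = subgroup_through[OF S u]
  have uS: "u \<in> S" using u by (simp add: central_def)
  have Sc: "x \<in> carrier G" if "x \<in> S" for x using that S' Ac by blast
  have uc: "u \<in> carrier G" by (rule Sc[OF uS])
  have JH: "\<not> J \<subseteq> H"
  proof
    assume "J \<subseteq> H"
    moreover obtain M' where "index_p A M'" "u \<in> M'" using not_commuting_index_p[OF A not_commuting] uS S' by blast
    ultimately show False using no_index_p_through[OF S u] by blast
  qed
  then obtain h where h: "h \<in> J" "h \<notin> H" by blast
  have hA: "h \<in> A" and hS: "h \<notin> S" using h J goodD(3)[OF S] by blast+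
  have hc: "h \<in> carrier G" using hA Ac by blast
  define D where "D = J \<inter> H"
  have D: "subgroup D G" unfolding D_def by (rule subgroup_inter[OF J(1) H'(1)])
  \<comment> \<open>\<open>JH\<close> leaves only \<open>J \<subseteq> M\<close> in the choice of
    \<open>M\<close>.\<close>
  have DS: "D \<subseteq> S" using M(3) JH H'(2) by (auto simp: D_def S_def third_def)
  have JSD: "x \<in> D" if "x \<in> J" "x \<in> S" for x using that goodD(3)[OF S] by (simp add: D_def)
  have hD: "h \<otimes> d \<otimes> inv h \<in> D" if "d \<in> D" for d
  proof -
    have d: "d \<in> J" "d \<in> H" using that by (auto simp: D_def)
    have "h \<otimes> d \<otimes> inv h \<in> J"
      by (rule subgroup.m_closed[OF J(1) subgroup.m_closed[OF J(1) h(1) d(1)] subgroup.m_inv_closed[OF J(1) h(1)]])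
    then show ?thesis using index_p_conj[OF A H hA d(2)] by (simp add: D_def)
  qed
  have hh: "h \<otimes> h \<in> D"
    using index_p_mult_iff[OF A H hA hA] subgroup.m_closed[OF J(1) h(1) h(1)] by (simp add: D_def)
  \<comment> \<open>If T contained \<open>D\<close>, the third subgroup \<open>W\<close> of
    \<open>S\<close> would contain \<open>u\<close> and \<open>D\<close> and be normalized by
    \<open>J\<close>, so \<open>W <#> J\<close> would be \<open>A\<close>. But \<open>W\<close> and
    \<open>J\<close> share \<open>D\<close>, leaving at most \<open>2 * card W\<close> elements,
    half of \<open>A\<close>.\<close>
  have DT: "\<not> D \<subseteq> ?T"
  proof
    assume DT: "D \<subseteq> ?T"
    have mT: "index_p S ?T" unfolding index_p_def using centre_mod_subgroup[OF A mS] centre_mod_sub str(1) p2 by simp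
    have mK: "index_p S (S \<inter> H)"
      unfolding index_p_def using index_p_inter[OF A mS H goodD(2)[OF S]] subgroup_inter[OF S'(1) H'(1)] by simp
    have TK: "?T \<noteq> S \<inter> H" using str(3) by blast
    define W where "W = third S ?T (S \<inter> H)"
    have mW: "index_p S W" unfolding W_def by (rule index_p_third[OF S'(1) mT mK TK])
    note W' = index_pD[OF mW]
    have Wiff: "s \<in> W \<longleftrightarrow> (s \<in> ?T \<longleftrightarrow> s \<in> H)" if "s \<in> S" for s
      using that by (auto simp: W_def third_def)
    have U: "subgroup (W <#> J) G"
    proof (rule subgroup_set_mult[OF W'(1) J(1)])
      fix j w assume jw: "j \<in> J" "w \<in> W"
      have jA: "j \<in> A" "inv j \<in> A" using jw(1) J(2) subgroup.m_inv_closed[OF J(1) jw(1)] by blast+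
      have jc: "j \<in> carrier G" "w \<in> carrier G" using jA jw W' Ac Sc by blast+
      have wS: "w \<in> S" using jw W' by blast
      have c: "inv j \<otimes> (j \<otimes> w \<otimes> inv j) \<otimes> inv (inv j) = w" using jc by (simp add: word)
      have "j \<otimes> w \<otimes> inv j \<in> ?T \<longleftrightarrow> w \<in> ?T"
        using centre_mod_conj[OF A mS jA(1), of w] centre_mod_conj[OF A mS jA(2), of "j \<otimes> w \<otimes> inv j"] c by auto
      moreover have "j \<otimes> w \<otimes> inv j \<in> H \<longleftrightarrow> w \<in> H"
        using index_p_conj[OF A H jA(1), of w] index_p_conj[OF A H jA(2), of "j \<otimes> w \<otimes> inv j"] c by auto
      ultimately show "j \<otimes> w \<otimes> inv j \<in> W"
        using Wiff[OF wS] Wiff[OF index_p_conj[OF A mS jA(1) wS]] jw by blast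
    qed
    have "W <#> J \<subseteq> A"
      using W' S' J subgroup.m_closed[OF A] by (auto simp: set_mult_def subset_iff)
    moreover have "u \<in> W" using Wiff[OF uS] u by blast
    ultimately have UA: "W <#> J = A"
      using through[OF U] set_mult_incl[OF W'(1) J(1)] by blast
    have "D \<subseteq> W" using DT DS Wiff by (auto simp: D_def)
    then have "D \<subseteq> W \<inter> J" by (auto simp: D_def)
    then have "card D \<le> card (W \<inter> J)"
      using subgroup_finite[OF J(1)] by (intro card_mono) auto
    then have "card D * card A \<le> card W * card J"
      using card_set_mult[OF W'(1) J(1)] UA by (simp add: mult_le_mono1)
    moreover have "card J \<le> 2 * card D"
    proof -
      have "card J * card H \<le> card A * card D"
        unfolding D_def by (rule card_inter[OF J(1) H'(1) A J(2) H'(2)])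
      then have "card H * card J \<le> card H * (2 * card D)" using H'(3) p2 by (simp add: ac_simps)
      then show ?thesis using subgroup_card_pos[OF H'(1)] by simp
    qed
    then have "card W * card J \<le> card W * (2 * card D)" by simp
    ultimately have "card D * card A \<le> card W * (2 * card D)" by (rule le_trans)
    then have "card D * card A \<le> card D * (2 * card W)" by (simp add: ac_simps)
    then have "card A \<le> 2 * card W" using subgroup_card_pos[OF D] by simp
    then show False using W'(3) S'(3) p2 subgroup_card_pos[OF W'(1)] by simp
  qed
  txt \<open>It remains to find a subgroup \<open>E = D \<union> y D\<close> that meets \<open>H\<close> and \<open>J\<close> only in \<open>D\<close> and satisfies
    \<open>E' = A'\<close>. We take \<open>y = h \<otimes> k\<close> with \<open>k\<close> in the centre \<open>Z\<close> of \<open>S\<close>, since \<open>S = Z D\<close>.\<close>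
  define Z where "Z = {z \<in> S. \<forall>s\<in>S. z \<otimes> s = s \<otimes> z}"
  have Zeq: "Z = \<Inter> (centralizer_in S ` S)"
    using S'(1) subgroup.one_closed by (auto simp: Z_def centralizer_in_def)
  have Z: "subgroup Z G"
    unfolding Zeq
  proof (rule subgroups_Inter)
    show "centralizer_in S ` S \<noteq> {}" using uS by blast
    show "subgroup V G" if "V \<in> centralizer_in S ` S" for V
      using that centralizer_in_subgroup[OF S'(1) Sc] by blast
  qed
  have ZS: "Z \<subseteq> S" by (auto simp: Z_def)
  have Zcomm: "z \<otimes> s = s \<otimes> z" if "z \<in> Z" "s \<in> S" for z s using that by (simp add: Z_def)
  have uZ: "u \<in> Z" using u by (auto simp: Z_def central_def)
  have Zconj: "a \<otimes> z \<otimes> inv a \<in> Z" if a: "a \<in> A" and z: "z \<in> Z" for a z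
  proof -
    have zS: "z \<in> S" using z ZS by blast
    have c: "a \<in> carrier G" "z \<in> carrier G" using a zS Ac Sc by blast+
    have "(a \<otimes> z \<otimes> inv a) \<otimes> s = s \<otimes> (a \<otimes> z \<otimes> inv a)" if s: "s \<in> S" for s
    proof -
      have sc: "s \<in> carrier G" using s Sc by blast
      have "inv a \<otimes> s \<otimes> inv (inv a) \<in> S" using index_p_conj[OF A mS subgroup.m_inv_closed[OF A a] s] .
      then have "inv a \<otimes> s \<otimes> a \<in> S" using c by simp
      from Zcomm[OF z this] have "a \<otimes> (z \<otimes> (inv a \<otimes> s \<otimes> a)) \<otimes> inv a = a \<otimes> ((inv a \<otimes> s \<otimes> a) \<otimes> z) \<otimes> inv a"
        by simp
      then show ?thesis using c sc by (simp add: word)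
    qed
    then show ?thesis using index_p_conj[OF A mS a zS] by (simp add: Z_def)
  qed
  \<comment> \<open>\<open>Z\<close> is normal in \<open>A\<close> and contains \<open>u\<close>.
    Intersecting with \<open>S\<close> then gives S = Z D.\<close>
  have ZJ: "Z <#> J = A"
  proof (rule through)
    show "subgroup (Z <#> J) G"
      using J(2) Zconj by (intro subgroup_set_mult Z J(1)) blast
    show "Z <#> J \<subseteq> A"
      using ZS S' J subgroup.m_closed[OF A] by (auto simp: set_mult_def subset_iff)
    show "u \<in> Z <#> J" "J \<subseteq> Z <#> J" using set_mult_incl[OF Z J(1)] uZ by blast+
  qed
  have SZD: "\<exists>z\<in>Z. \<exists>d\<in>D. s = z \<otimes> d" if s: "s \<in> S" for s
  proof -
    have "s \<in> Z <#> J" using s S' ZJ by blast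
    then obtain z j where zj: "z \<in> Z" "j \<in> J" "s = z \<otimes> j" by (auto simp: set_mult_def)
    have zS: "z \<in> S" using zj ZS by blast
    have jc: "j \<in> carrier G" using zj J Ac by blast
    have "inv z \<otimes> s \<in> S" using subgroup.m_closed[OF S'(1) subgroup.m_inv_closed[OF S'(1) zS] s] .
    then have "j \<in> S" using zj(3) jc Sc[OF zS] by simp
    then show ?thesis using zj JSD by blast
  qed
  have comZ: "comm (z \<otimes> d) y = comm d y" if "z \<in> Z" "d \<in> S" "y \<in> S" for z d y
  proof (rule comm_central)
    show "z \<otimes> (d \<otimes> y \<otimes> inv d) = (d \<otimes> y \<otimes> inv d) \<otimes> z"
      by (rule Zcomm[OF that(1) subgroup.m_closed[OF S'(1) subgroup.m_closed[OF S'(1) that(2,3)]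
            subgroup.m_inv_closed[OF S'(1) that(2)]]])
  qed (use that ZS Sc in auto)
  have "derived G S \<subseteq> derived G D"
  proof (rule derived_least[OF derived_subgroup[OF D]])
    fix x y assume "x \<in> S" "y \<in> S"
    then obtain z d z' d' where e: "z \<in> Z" "d \<in> D" "x = z \<otimes> d" "z' \<in> Z" "d' \<in> D" "y = z' \<otimes> d'"
      using SZD by metis
    have dS: "d \<in> S" "d' \<in> S" using e DS by blast+
    have "comm x y = inv (comm y d)"
      using e(1,3) comZ[OF e(1) dS(1) \<open>y \<in> S\<close>] inv_comm[OF Sc[OF \<open>y \<in> S\<close>] Sc[OF dS(1)]] by simp
    also have "comm y d = comm d' d" using comZ[OF e(4) dS(2) dS(1)] e(6) by simp
    also have "inv (comm d' d) = comm d d'" using inv_comm Sc dS by blast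
    finally show "comm x y \<in> derived G D" using comm_derived e by metis
  qed
  then have dSD: "derived G S = derived G D" using mono_derived[OF DS] by blast
  have hD2: "2 * card D \<le> card J"
  proof -
    have "D \<subset> J" using h by (auto simp: D_def)
    then show ?thesis using proper_card[OF D J(1)] p2 by simp
  qed
  \<comment> \<open>Otherwise \<open>D\<close> and its translate by \<open>u\<close> cover
    \<open>S\<close>, and \<open>A\<close> has at most \<open>4 * card D \<le> 2 * card J\<close>
    elements.\<close>
  have "\<exists>k\<in>Z. k \<in> H \<and> k \<notin> D"
  proof (rule ccontr)
    assume no: "\<not> ?thesis"
    have "S \<subseteq> D \<union> (\<lambda>d. u \<otimes> d) ` D"
    proof
      fix s assume "s \<in> S"
      then obtain z d where zd: "z \<in> Z" "d \<in> D" "s = z \<otimes> d" using SZD by blast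
      have c: "z \<in> carrier G" "d \<in> carrier G" "z \<in> A" using zd ZS DS Sc S' by blast+
      show "s \<in> D \<union> (\<lambda>d. u \<otimes> d) ` D"
      proof (cases "z \<in> H")
        case True
        then have "z \<in> D" using no zd by blast
        then show ?thesis using subgroup.m_closed[OF D _ zd(2), of z] zd(3) by simp
      next
        case False
        have "inv u \<in> A" "inv u \<notin> H"
        proof -
          show "inv u \<in> A" using uS S'(2) by (intro subgroup.m_inv_closed[OF A]) blast
          show "inv u \<notin> H" using u(2) subgroup.m_inv_closed[OF H'(1), of "inv u"] uc by auto
        qed
        then have "inv u \<otimes> z \<in> H" using index_p_mult_iff[OF A H _ c(3)] False by blast
        moreover have "inv u \<otimes> z \<in> Z" using subgroup.m_closed[OF Z subgroup.m_inv_closed[OF Z uZ] zd(1)] .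
        ultimately have "inv u \<otimes> z \<in> D" using no by blast
        then have "(inv u \<otimes> z) \<otimes> d \<in> D" by (rule subgroup.m_closed[OF D _ zd(2)])
        moreover have "s = u \<otimes> ((inv u \<otimes> z) \<otimes> d)" using zd(3) c uc by (simp add: m_assoc)
        ultimately show ?thesis by blast
      qed
    qed
    moreover have fD: "finite D" by (rule subgroup_finite[OF D])
    ultimately have "card S \<le> card (D \<union> (\<lambda>d. u \<otimes> d) ` D)" by (intro card_mono) auto
    also have "\<dots> \<le> card D + card ((\<lambda>d. u \<otimes> d) ` D)" by (rule card_Un_le)
    also have "\<dots> \<le> card D + card D" using card_image_le[OF fD] by simp
    finally have "card A \<le> 4 * card D" using S'(3) p2 by simp
    then show False using hD2 J(3) subgroup_card_pos[OF D] by linarith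
  qed
  then obtain k0 where k0: "k0 \<in> Z" "k0 \<in> H" "k0 \<notin> D" by blast
  let ?c = "\<lambda>k. h \<otimes> k \<otimes> inv h"
  \<comment> \<open>The last condition puts the square of \<open>h \<otimes> k\<close> into
    \<open>D\<close>. If \<open>k0\<close> fails, its product with its conjugate commutes with
    \<open>h\<close>, because \<open>h \<otimes> h\<close> lies in \<open>S\<close>; then an element
    commuting with \<open>h\<close> whose square lies in \<open>D\<close> will do.\<close>
  have "\<exists>k\<in>Z. k \<in> H \<and> k \<notin> D \<and> k \<otimes> ?c k \<in> D"
  proof (cases "k0 \<otimes> ?c k0 \<in> D")
    case True
    then show ?thesis using k0 by blast
  next
    case False
    let ?k = "k0 \<otimes> ?c k0"
    have cS: "?c k0 \<in> Z" "?c k0 \<in> H" using Zconj[OF hA k0(1)] index_p_conj[OF A H hA k0(2)] .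
    have kc: "k0 \<in> carrier G" "?c k0 \<in> carrier G" using k0 cS ZS Sc by blast+
    have hhk: "k0 \<otimes> (h \<otimes> h) = (h \<otimes> h) \<otimes> k0" using Zcomm[OF k0(1)] hh DS by blast
    have "?c ?k = ?c k0 \<otimes> (((h \<otimes> h) \<otimes> k0) \<otimes> inv h \<otimes> inv h)" using hc kc by (simp add: word)
    also have "\<dots> = ?c k0 \<otimes> k0" unfolding hhk[symmetric] using hc kc by (simp add: word)
    also have "\<dots> = ?k" using Zcomm[OF k0(1) subsetD[OF ZS cS(1)]] by (rule sym)
    finally have "?c ?k = ?k" .
    then have "h \<otimes> ?k = ?k \<otimes> h" using hc kc by (simp add: inv_solve_right')
    define Y where "Y = Z \<inter> (H \<inter> centralizer_in A h)"
    have Y: "subgroup Y G" unfolding Y_def by (intro subgroup_inter Z H'(1) centralizer_in_subgroup A hc)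
    have "?k \<in> Z" "?k \<in> H"
      using subgroup.m_closed[OF Z k0(1) cS(1)] subgroup.m_closed[OF H'(1) k0(2) cS(2)] .
    then have "?k \<in> Y - D"
      using False \<open>h \<otimes> ?k = ?k \<otimes> h\<close> H' by (auto simp: Y_def centralizer_in_def)
    then obtain y where y: "y \<in> Y - D" "y [^] p \<in> D" using pth_power_exists[OF D Y] by blast
    have yc: "y \<in> carrier G" and yh: "y \<otimes> h = h \<otimes> y" using y ZS Sc by (auto simp: Y_def centralizer_in_def)
    have "?c y = y" unfolding yh[symmetric] using yc hc by (simp add: m_assoc)
    moreover have "y \<otimes> y \<in> D" using y(2) yc p2 by (simp add: numeral_2_eq_2)
    ultimately show ?thesis using y by (auto simp: Y_def)
  qed
  then obtain k where k: "k \<in> Z" "k \<in> H" "k \<notin> D" "k \<otimes> ?c k \<in> D" by blast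
  have kS: "k \<in> S" using k ZS by blast
  have kA: "k \<in> A" and kc: "k \<in> carrier G" using kS S' Sc by blast+
  define y where "y = h \<otimes> k"
  have yA: "y \<in> A" unfolding y_def by (rule subgroup.m_closed[OF A hA kA])
  have yc: "y \<in> carrier G" using yA Ac by blast
  have yH: "y \<notin> H" unfolding y_def using index_p_mult_iff[OF A H hA kA] h k by blast
  have yS: "y \<notin> S" unfolding y_def using index_p_mult_iff[OF A mS hA kA] hS kS by blast
  have yy: "y [^] p \<in> D"
  proof -
    have hhk: "k \<otimes> (h \<otimes> h) = (h \<otimes> h) \<otimes> k" using Zcomm[OF k(1)] hh DS by blast
    have "y [^] p = ?c k \<otimes> ((h \<otimes> h) \<otimes> k)" using p2 hc kc by (simp add: y_def numeral_2_eq_2 word)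
    also have "\<dots> = (?c k \<otimes> k) \<otimes> (h \<otimes> h)" unfolding hhk[symmetric] using hc kc by (simp add: word)
    also have "?c k \<otimes> k = k \<otimes> ?c k" using Zcomm[OF Zconj[OF hA k(1)] kS] .
    finally show ?thesis using k(4) hh subgroup.m_closed[OF D] by simp
  qed
  have yD: "y \<otimes> d \<otimes> inv y \<in> D" if d: "d \<in> D" for d
  proof -
    have dc: "d \<in> carrier G" using d DS Sc by blast
    have "k \<otimes> d = d \<otimes> k" using Zcomm[OF k(1)] d DS by blast
    then have "y \<otimes> d \<otimes> inv y = h \<otimes> ((d \<otimes> k) \<otimes> (inv k \<otimes> inv h))"
      unfolding y_def using hc kc dc by (simp add: word)
    also have "\<dots> = h \<otimes> d \<otimes> inv h" using hc kc dc by (simp add: word)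
    finally show ?thesis using hD[OF d] by simp
  qed
  let ?C = "generate G {y}"
  have C: "subgroup ?C G" using yc by (simp add: generate_is_subgroup)
  have yC: "y \<in> ?C" by (rule generate.incl) simp
  have CN: "?C \<subseteq> {a \<in> A. \<forall>d\<in>D. a \<otimes> d \<otimes> inv a \<in> D}"
    by (rule generate_subgroup_incl[OF _ normalizer_subgroup[OF D A]]) (use yA yD in auto)
  define E where "E = D <#> ?C"
  have E: "subgroup E G"
    unfolding E_def using CN by (intro subgroup_set_mult D C) blast
  have DE: "D \<subseteq> E" and yE: "y \<in> E" unfolding E_def using set_mult_incl[OF D C] yC by blast+
  have EA: "E \<subseteq> A"
    unfolding E_def using DS S' CN subgroup.m_closed[OF A] by (auto simp: set_mult_def subset_iff)
  have "card (D \<inter> ?C) * card E \<le> card (D \<inter> ?C) * (p * card D)"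
  proof -
    have "card D * card ?C \<le> card D * (p * card (D \<inter> ?C))"
      using card_generate_le[OF D yc yy] by simp
    then show ?thesis using card_set_mult[OF D C] by (simp add: E_def ac_simps)
  qed
  then have "card E \<le> p * card D" using subgroup_card_pos[OF subgroup_inter[OF D C]] by simp
  moreover have "y \<notin> D" using yS DS by blast
  then have "D \<subset> E" using DE yE by blast
  then have "p * card D \<le> card E" by (rule proper_card[OF D E])
  ultimately have mD: "index_p E D" unfolding index_p_def using D DE by simp
  \<comment> \<open>Such an \<open>e\<close> is \<open>y \<otimes> d\<close> with \<open>d\<close>
    in \<open>D\<close>; if it were in \<open>J\<close>, so would be \<open>k\<close>, which lies in
    \<open>S\<close> and would thus be in \<open>D\<close>.\<close>
  have Eout: "e \<notin> H \<and> e \<notin> J" if e: "e \<in> E" "e \<notin> D" for e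
  proof -
    have iyE: "inv y \<in> E" by (rule subgroup.m_inv_closed[OF E yE])
    have "inv y \<notin> D" using subgroup.m_inv_closed[OF D, of "inv y"] yc \<open>y \<notin> D\<close> by auto
    then have dD: "inv y \<otimes> e \<in> D" using index_p_mult_iff[OF E mD iyE e(1)] e(2) by blast
    define d where "d = inv y \<otimes> e"
    have ec: "e \<in> carrier G" using e EA Ac by blast
    have ed: "e = y \<otimes> d" using ec yc by (simp add: d_def)
    have d: "d \<in> D" "d \<in> A" "d \<in> H" "d \<in> J" using dD DS S' by (auto simp: d_def D_def)
    have "e \<notin> H" unfolding ed using index_p_mult_iff[OF A H yA d(2)] yH d(3) by blast
    moreover have "e \<notin> J"
    proof
      assume "e \<in> J"
      then have "inv h \<otimes> e \<otimes> inv d \<in> J"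
        by (rule subgroup.m_closed[OF J(1) subgroup.m_closed[OF J(1) subgroup.m_inv_closed[OF J(1) h(1)]]
              subgroup.m_inv_closed[OF J(1) d(4)]])
      moreover have "inv h \<otimes> e \<otimes> inv d = k"
        unfolding ed y_def using hc kc Ac[OF d(2)] by (simp add: word)
      ultimately show False using JSD kS k(3) by blast
    qed
    ultimately show ?thesis by blast
  qed
  have "card E = 2 * card D" using index_pD(3)[OF mD] p2 by simp
  then have "card E < card A" using hD2 J(3) subgroup_card_pos[OF D] by linarith
  then have "breadth_bound E" by (rule IH[OF E])
  then have dE: "card (derived G E) \<le> p ^ (m * (m + 1) div 2)"
  proof (rule breadth_bound_single[OF _ E \<open>D \<subset> E\<close> D])
    fix e assume "e \<in> E" "e \<notin> D"
    moreover from this have "e \<in> A" "e \<notin> H" "e \<notin> J" using Eout EA by blast+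
    ultimately show "card E \<le> p ^ m * card (centralizer_in E e)"
      by (intro breadth_mono[OF A E EA Ac] breadth)
  qed
  \<comment> \<open>The commutator of \<open>y\<close> and \<open>d\<close> lies in E' but not in
    S', so E' has at least twice the order of S', that is, the order of A'.\<close>
  obtain d where d: "d \<in> D" "d \<notin> ?T" using DT by blast
  have dS: "d \<in> S" using d DS by blast
  have "comm y d \<notin> derived G S" using centre_mod_iff[OF A mS yA yS dS] d by blast
  moreover have "comm y d \<in> derived G E" using comm_derived yE d DE by blast
  moreover have "derived G S \<subseteq> derived G E" using dSD mono_derived[OF DE] by simp
  ultimately have "derived G S \<subset> derived G E" by blast
  then have "p * card (derived G S) \<le> card (derived G E)"
    by (rule proper_card[OF derived_subgroup[OF S'(1)] derived_subgroup[OF E]])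
  then show False using str(2) dE big p2 by simp
qed

end

section \<open>The induction over subgroups and the return to \<open>breadth\<close>\<close>

context finite_p_group
begin

lemma index_p_enlarge:
  assumes A: "subgroup A G" and fin: "finite \<H>" and H: "\<And>H. H \<in> \<H> \<Longrightarrow> subgroup H G \<and> H \<subset> A"
  shows "\<exists>\<K>. finite \<K> \<and> card \<K> \<le> card \<H> \<and> (\<forall>K\<in>\<K>. index_p A K) \<and> \<Union>\<H> \<subseteq> \<Union>\<K>"
proof -
  have "\<forall>H\<in>\<H>. \<exists>S. index_p A S \<and> H \<subseteq> S" using index_p_exists[OF _ A] H by blast
  then obtain f where f: "\<forall>H\<in>\<H>. index_p A (f H) \<and> H \<subseteq> f H" by (rule bchoice[THEN exE])
  then show ?thesis using fin card_image_le[OF fin, of f] by (intro exI[of _ "f ` \<H>"]) auto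
qed

text \<open>Fewer than \<open>p\<close> subgroups of index \<open>p\<close> do not cover
  \<open>A\<close>, and an uncovered element lies in a further one because \<open>A\<close> is not
  abelian.\<close>

lemma index_p_pad:
  assumes A: "subgroup A G" and ab: "\<not> commuting A" and n: "card \<H> \<le> n" "n \<le> p"
    and fin: "finite \<H>" and H: "\<forall>H\<in>\<H>. index_p A H"
  shows "\<exists>\<K>. finite \<K> \<and> card \<K> = n \<and> (\<forall>K\<in>\<K>. index_p A K) \<and> \<H> \<subseteq> \<K>"
  using n
proof (induction n rule: dec_induct)
  case base
  then show ?case using fin H by blast
next
  case (step k)
  then obtain \<K> where K: "finite \<K>" "card \<K> = k" "\<forall>K\<in>\<K>. index_p A K" "\<H> \<subseteq> \<K>" by auto
  obtain a where a: "a \<in> A" "a \<notin> \<Union>\<K>"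
    using index_p_no_cover[OF A K(1) _ _ triv_subgroup] K step not_commuting_card[OF A ab] by auto
  then obtain S where "index_p A S" "a \<in> S" using not_commuting_index_p[OF A ab] by blast
  then show ?case using K a by (intro exI[of _ "insert S \<K>"]) auto
qed

text \<open>Strong induction on the order. In the nonabelian case the family is enlarged to exactly
  \<open>p - 1\<close> subgroups of index \<open>p\<close>; the larger union only exempts more
  elements from the breadth condition.\<close>

lemma breadth_bound_subgroup:
  assumes "subgroup A G" shows "breadth_bound A"
  using assms
proof (induction "card A" arbitrary: A rule: less_induct)
  case less
  note A = less.prems
  have IH: "breadth_bound S" if "subgroup S G" "card S < card A" for S using less.hyps that by blast
  show ?case
    unfolding breadth_bound_def
  proof (intro allI impI, elim conjE)
    fix \<H> J m
    assume fin: "finite \<H>" and c: "card \<H> \<le> p - 1" and H: "\<forall>H\<in>\<H>. subgroup H G \<and> H \<subset> A"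
      and J: "subgroup J G" "J \<subseteq> A" and J1: "p\<^sup>2 * card J \<le> card A \<or> J = {\<one>}"
      and b: "\<forall>x\<in>A. x \<notin> \<Union>\<H> \<and> x \<notin> J \<longrightarrow> card A \<le> p ^ m * card (centralizer_in A x)"
    show "card (derived G A) \<le> p ^ (m * (m + 1) div 2)"
    proof (cases "commuting A")
      case True
      then show ?thesis using commuting_derived[OF A] p_ge2 by simp
    next
      case False
      have J2: "p\<^sup>2 * card J \<le> card A" using J1 not_commuting_card[OF A False] by auto
      obtain \<K>0 where K0: "finite \<K>0" "card \<K>0 \<le> card \<H>" "\<forall>K\<in>\<K>0. index_p A K" "\<Union>\<H> \<subseteq> \<Union>\<K>0"
        using index_p_enlarge[OF A fin] H by blast
      obtain \<K> where K: "finite \<K>" "card \<K> = p - 1" "\<forall>K\<in>\<K>. index_p A K" "\<K>0 \<subseteq> \<K>"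
        using index_p_pad[OF A False _ _ K0(1,3), of "p - 1"] K0(2) c by auto
      have bK: "card A \<le> p ^ m * card (centralizer_in A x)" if "x \<in> A" "x \<notin> \<Union>\<K>" "x \<notin> J" for x
        using that b K K0 by blast
      show ?thesis
      proof (cases "p = 2")
        case True
        then obtain H where HK: "\<K> = {H}" using K(2) by (auto simp: card_1_singleton_iff)
        show ?thesis
        proof (rule ccontr)
          assume "\<not> ?thesis"
          then have "index2_step G p A H J m"
            using A J J2 True K(3) HK bK IH
            by (intro index2_step.intro finite_p_group_axioms index2_step_axioms.intro) auto
          then show False by (rule index2_step.contradiction)
        qed
      next
        case p3: False
        show ?thesis
          by (rule breadth_bound_step_odd[OF A IH False _ K(1,2) _ J J2 bK]) (use p3 p_ge2 K(3) in auto)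
      qed
    qed
  qed
qed

lemma centralizer_eq: "centralizer G x = centralizer_in (carrier G) x"
  by (simp add: centralizer_def centralizer_in_def)

text \<open>By Lagrange the index of a centralizer is a power of \<open>p\<close>, so the
  description in \<open>breadth\<close> denotes its exponent.\<close>

lemma card_breadth:
  assumes x: "x \<in> carrier G"
  shows "card (carrier G) = p ^ breadth G p x * card (centralizer_in (carrier G) x)"
proof -
  let ?C = "centralizer_in (carrier G) x"
  have C: "subgroup ?C G" by (rule centralizer_in_subgroup[OF subgroup_self x])
  have l: "card (rcosets ?C) * card ?C = card (carrier G)"
    using lagrange[OF C] by (simp add: order_def)
  obtain k where k: "card (carrier G) = p ^ k" using card_G by blast
  have "card (rcosets ?C) dvd p ^ k" using l k by (metis dvd_triv_left)
  then obtain i where i: "card (rcosets ?C) = p ^ i"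
    using divides_primepow_nat[OF prime_p] by blast
  have "breadth G p x = i"
    unfolding breadth_def centralizer_eq i
    by (rule the_equality) (use p_ge2 in \<open>auto simp: power_inject_exp\<close>)
  then show ?thesis using l i by simp
qed

end

text \<open>A subgroup of index at least \<open>p ^ 2\<close> becomes \<open>J\<close>, the others
  form \<open>\<H>\<close>, and elements outside all of them have breadth less than
  \<open>n\<close>.\<close>

theorem theorem2p3:
  fixes G :: "('a, 'b) monoid_scheme" and p n :: nat
  assumes "Factorial_Ring.prime p"
    and "p_group G p"
    and "card (derived G (carrier G)) > p ^ (n * (n - 1) div 2)"
  shows "\<not> (\<exists>H :: nat \<Rightarrow> 'a set.
            (\<forall>i \<in> {1..p}. subgroup (H i) G \<and> H i \<noteq> carrier G)
          \<and> (\<exists>i \<in> {1..p}. card (rcosets\<^bsub>G\<^esub> (H i)) \<ge> p ^ 2)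
          \<and> (\<forall>x \<in> carrier G. breadth G p x \<ge> n \<longrightarrow> x \<in> (\<Union>i \<in> {1..p}. H i)))"
proof
  assume "\<exists>H :: nat \<Rightarrow> 'a set.
            (\<forall>i \<in> {1..p}. subgroup (H i) G \<and> H i \<noteq> carrier G)
          \<and> (\<exists>i \<in> {1..p}. card (rcosets\<^bsub>G\<^esub> (H i)) \<ge> p ^ 2)
          \<and> (\<forall>x \<in> carrier G. breadth G p x \<ge> n \<longrightarrow> x \<in> (\<Union>i \<in> {1..p}. H i))"
  then obtain H :: "nat \<Rightarrow> 'a set" and j
    where H: "\<And>i. i \<in> {1..p} \<Longrightarrow> subgroup (H i) G" "\<And>i. i \<in> {1..p} \<Longrightarrow> H i \<noteq> carrier G"
      and j: "j \<in> {1..p}" "card (rcosets\<^bsub>G\<^esub> (H j)) \<ge> p ^ 2"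
      and cover: "\<And>x. x \<in> carrier G \<Longrightarrow> breadth G p x \<ge> n \<Longrightarrow> x \<in> (\<Union>i \<in> {1..p}. H i)"
    by blast
  interpret group G using assms(2) by (simp add: p_group_def)
  interpret finite_p_group G p
    by unfold_locales (use assms(1,2) in \<open>auto simp: p_group_def\<close>)
  define \<H> where "\<H> = H ` ({1..p} - {j})"
  have fin: "finite \<H>" by (simp add: \<H>_def)
  have "card \<H> \<le> card ({1..p} - {j})" unfolding \<H>_def by (rule card_image_le) simp
  then have c: "card \<H> \<le> p - 1" using j(1) by simp
  have sub: "K \<in> \<H> \<Longrightarrow> subgroup K G \<and> K \<subset> carrier G" for K
    using H subgroup.subset by (fastforce simp: \<H>_def)
  have J: "subgroup (H j) G" "H j \<subseteq> carrier G" using H(1)[OF j(1)] subgroup.subset by auto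
  have Jc: "p\<^sup>2 * card (H j) \<le> card (carrier G)"
    using lagrange[OF J(1)] mult_le_mono1[OF j(2), of "card (H j)"] by (simp add: order_def)
  have out: "breadth G p x < n" if "x \<in> carrier G" "x \<notin> \<Union>\<H>" "x \<notin> H j" for x
    using cover[OF that(1)] that(2,3) by (fastforce simp: \<H>_def not_le[symmetric])
  show False
  proof (cases n)
    \<comment> \<open>Every breadth is at least 0, so the subgroups would cover \<open>G\<close>;
      counting excludes this directly, as no \<open>m\<close> with \<open>n = Suc m\<close>
      exists.\<close>
    case 0
    obtain \<K> where K: "finite \<K>" "card \<K> \<le> card \<H>" "\<forall>K\<in>\<K>. index_p (carrier G) K" "\<Union>\<H> \<subseteq> \<Union>\<K>"
      using index_p_enlarge[OF subgroup_self fin sub] by blast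
    moreover from this have "card \<K> \<le> p" using c by linarith
    ultimately obtain x where "x \<in> carrier G" "x \<notin> \<Union>\<K>" "x \<notin> H j"
      using index_p_no_cover[OF subgroup_self K(1) _ _ J(1) Jc] K(3) \<open>card \<K> \<le> p\<close> by auto
    then show False using out[of x] K(4) 0 by auto
  next
    case (Suc m)
    have "card (derived G (carrier G)) \<le> p ^ (m * (m + 1) div 2)"
    proof (rule breadth_boundD[OF breadth_bound_subgroup[OF subgroup_self] fin c sub J])
      fix x assume x: "x \<in> carrier G" "x \<notin> \<Union>\<H>" "x \<notin> H j"
      have "breadth G p x \<le> m" using out[OF x] Suc by simp
      then have "p ^ breadth G p x \<le> p ^ m" using p_ge2 by (intro power_increasing) auto
      then show "card (carrier G) \<le> p ^ m * card (centralizer_in (carrier G) x)"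
        using card_breadth[OF x(1)] by simp
    qed (use Jc in auto)
    then show False using assms(3) Suc by (simp add: mult.commute)
  qed
qed

end
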